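(* Let $\Gamma, H,\pi,\alpha,M,\tau,(X,m),\beta$ and $T\colon H\to L^0(X,m)$ be as in the setting described in the context. Then the map $T$ factors $\Gamma$-equivariantly through a Hilbert space. More precisely, there exists a $\Gamma$-invariant function $\varphi\in L^0(X,m)$ which is $m$-a.e. (strictly) positive and satisfies $$\int_X\varphi(x)\,[T\xi](x)^2\,\mathrm{d}m(x)\le\|\xi\|^2,\qquad \xi\in H.$$ In particular, with the $\Gamma$-invariant function $\psi=\varphi^{-1/2}$, the multiplication operator $M_\psi\colon h\mapsto\psi h$, and $\tilde T\xi:=\varphi^{1/2}\cdot T\xi$, one has that $\tilde T$ maps $H$ into $L^2(X,m)$, $\tilde T$ is $\Gamma$-equivariant (i.e. $\tilde T(\pi(s)\xi)=\beta_s(\tilde T\xi)$ for all $s\in\Gamma$, $\xi\in H$), and $T=M_\psi\circ\tilde T$.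
   Context: Setting. $\Gamma$ is a countable discrete group, $H$ a separable complex Hilbert space, and $\pi\colon\Gamma\to\mathbb{B}(H)$ a uniformly bounded representation, i.e. a homomorphism into the bounded invertible operators with $\sup_{s\in\Gamma}\|\pi(s)\|<\infty$. $G=H\rtimes_\pi\Gamma$ is $H\times\Gamma$ with multiplication $(\xi,s)(\eta,t)=(\xi+\pi(s)\eta,st)$ and the product topology. It is assumed that $G$ is of finite type, and one fixes a II$_1$-factor $M$ with separable predual and normal faithful tracial state $\tau$, acting on $L^2(M,\tau)$, together with a topological group isomorphism $\alpha$ from $G$ onto a closed subgroup of the unitary group $\mathcal{U}(M)$ (strong operator topology). Write $\alpha(\xi)=\alpha(\xi,1)$ for $\xi\in H$ and $\alpha(s)=\alpha(0,s)$ for $s\in\Gamma$; then $\alpha(\pi(s)\xi)=\alpha(s)\alpha(\xi)\alpha(s)^*$. For $\xi\in H$, $T(\xi)$ is the unique self-adjoint operator affiliated with $M$ such that $\alpha(t\xi)=e^{itT(\xi)}$ for all $t\in\mathbb{R}$. Let $\mathcal{A}=\{\alpha(\xi):\xi\in H\}''\subset M$, a commutative von Neumann algebra, and fix an identification $(\mathcal{A},\tau|_{\mathcal{A}})\cong(L^\infty(X,m),\int_X\cdot\,\mathrm{d}m)$ with $X$ a compact metrizable space and $m$ a Borel probability measure. $\beta_s=\mathrm{Ad}(\alpha(s))|_{\mathcal{A}}$ is a trace-preserving action of $\Gamma$ on $\mathcal{A}$, which comes from an $m$-preserving action $(s,x)\mapsto s\cdot x$ of $\Gamma$ on $X$ via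 $\beta_s(h)=h(s^{-1}\cdot\,)$; the same formula defines $\beta_s$ on $L^0(X,m)$, the space of ($m$-a.e. classes of) measurable complex functions on $X$ with the topology of convergence in measure. Closed densely defined operators affiliated with $\mathcal{A}$ are identified with elements of $L^0(X,m)$, so $T$ is regarded as a map from $H$ to the real-valued functions in $L^0(X,m)$. *)

theory Defs
  imports "HOL-Probability.Probability" "HOL-Algebra.Group_Action"
begin

section \<open>Complex Hilbert spaces and bounded operators\<close>

text \<open>The inner product is conjugate-linear in its first argument.\<close>

class chilbert_space = banach +
  fixes scaleC :: "complex \<Rightarrow> 'a \<Rightarrow> 'a" (infixr \<open>*\<^sub>C\<close> 75)
    and cinner :: "'a \<Rightarrow> 'a \<Rightarrow> complex"
  assumes scaleC_add_right: "c *\<^sub>C (x + y) = c *\<^sub>C x + c *\<^sub>C y"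
    and scaleC_add_left: "(c + d) *\<^sub>C x = c *\<^sub>C x + d *\<^sub>C x"
    and scaleC_scaleC: "c *\<^sub>C d *\<^sub>C x = (c * d) *\<^sub>C x"
    and scaleC_of_real: "complex_of_real r *\<^sub>C x = r *\<^sub>R x"
    and cinner_commute: "cinner x y = cnj (cinner y x)"
    and cinner_add_right: "cinner x (y + z) = cinner x y + cinner x z"
    and cinner_scaleC_right: "cinner x (c *\<^sub>C y) = c * cinner x y"
    and cinner_self: "cinner x x = complex_of_real ((norm x)\<^sup>2)"

definition bounded_clinear :: "('a::chilbert_space \<Rightarrow> 'b::chilbert_space) \<Rightarrow> bool" where
  "bounded_clinear f \<longleftrightarrow> bounded_linear f \<and> (\<forall>c x. f (c *\<^sub>C x) = c *\<^sub>C f x)"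

text \<open>For a bounded operator the adjoint exists by the Riesz representation theorem, and it is
  unique.\<close>

definition cadjoint :: "('a::chilbert_space \<Rightarrow> 'a) \<Rightarrow> 'a \<Rightarrow> 'a" where
  "cadjoint f = (THE g. \<forall>x y. cinner (f x) y = cinner x (g y))"

definition GL_group :: "('h::chilbert_space \<Rightarrow> 'h) monoid" where
  "GL_group = \<lparr>carrier = {f. bounded_clinear f \<and> (\<exists>g. bounded_clinear g \<and> f \<circ> g = id \<and> g \<circ> f = id)},
     mult = (\<circ>), one = id\<rparr>"

definition uniformly_bounded_rep ::
    "('g, 'b) monoid_scheme \<Rightarrow> ('g \<Rightarrow> 'h::chilbert_space \<Rightarrow> 'h) \<Rightarrow> bool" where
  "uniformly_bounded_rep \<Gamma> \<pi> \<longleftrightarrow>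
     \<pi> \<in> hom \<Gamma> GL_group \<and> (\<exists>C. \<forall>s\<in>carrier \<Gamma>. onorm (\<pi> s) \<le> C)"

definition semidirect ::
    "('g, 'b) monoid_scheme \<Rightarrow> ('g \<Rightarrow> 'h::chilbert_space \<Rightarrow> 'h) \<Rightarrow> ('h \<times> 'g) monoid" where
  "semidirect \<Gamma> \<pi> = \<lparr>carrier = UNIV \<times> carrier \<Gamma>,
     mult = (\<lambda>(\<xi>, s) (\<eta>, t). (\<xi> + \<pi> s \<eta>, s \<otimes>\<^bsub>\<Gamma>\<^esub> t)),
     one = (0, \<one>\<^bsub>\<Gamma>\<^esub>)\<rparr>"


section \<open>Von Neumann algebras\<close>

definition commutant :: "('k::chilbert_space \<Rightarrow> 'k) set \<Rightarrow> ('k \<Rightarrow> 'k) set" where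
  "commutant S = {x. bounded_clinear x \<and> (\<forall>y\<in>S. x \<circ> y = y \<circ> x)}"

definition von_neumann_algebra :: "('k::chilbert_space \<Rightarrow> 'k) set \<Rightarrow> bool" where
  "von_neumann_algebra M \<longleftrightarrow>
     (\<forall>x\<in>M. bounded_clinear x \<and> cadjoint x \<in> M) \<and> commutant (commutant M) = M"

definition projections :: "('k::chilbert_space \<Rightarrow> 'k) set \<Rightarrow> ('k \<Rightarrow> 'k) set" where
  "projections M = {p\<in>M. p \<circ> p = p \<and> cadjoint p = p}"

text \<open>Murray--von Neumann type II1: a factor whose unit is a finite projection and which has no
  minimal projection. For projections, \<open>q \<le> p\<close> means \<open>p \<circ> q = q\<close>.\<close>

definition II1_factor :: "('k::chilbert_space \<Rightarrow> 'k) set \<Rightarrow> bool" where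
  "II1_factor M \<longleftrightarrow> von_neumann_algebra M
     \<and> M \<inter> commutant M = range (\<lambda>c v. c *\<^sub>C v)
     \<and> (\<forall>v\<in>M. cadjoint v \<circ> v = id \<longrightarrow> v \<circ> cadjoint v = id)
     \<and> \<not> (\<exists>p\<in>projections M. p \<noteq> (\<lambda>_. 0) \<and>
            (\<forall>q\<in>projections M. p \<circ> q = q \<longrightarrow> q = (\<lambda>_. 0) \<or> q = p))"

text \<open>The normal (that is, ultraweakly continuous linear) functionals on \<open>M\<close>. Only the values on
  \<open>M\<close> matter.\<close>

definition predual :: "('k::chilbert_space \<Rightarrow> 'k) set \<Rightarrow> (('k \<Rightarrow> 'k) \<Rightarrow> complex) set" where
  "predual M = {\<omega>. \<exists>\<xi> \<eta> :: nat \<Rightarrow> 'k.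
     summable (\<lambda>n. (norm (\<xi> n))\<^sup>2) \<and> summable (\<lambda>n. (norm (\<eta> n))\<^sup>2) \<and>
     (\<forall>x\<in>M. \<omega> x = (\<Sum>n. cinner (\<xi> n) (x (\<eta> n))))}"

definition separable_predual :: "('k::chilbert_space \<Rightarrow> 'k) set \<Rightarrow> bool" where
  "separable_predual M \<longleftrightarrow> (\<exists>D \<subseteq> predual M. countable D \<and>
     (\<forall>\<omega>\<in>predual M. \<forall>e>0. \<exists>\<omega>'\<in>D. \<forall>x\<in>M. onorm x \<le> 1 \<longrightarrow> cmod (\<omega> x - \<omega>' x) \<le> e))"

definition normal_faithful_tracial_state ::
    "('k::chilbert_space \<Rightarrow> 'k) set \<Rightarrow> (('k \<Rightarrow> 'k) \<Rightarrow> complex) \<Rightarrow> bool" where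
  "normal_faithful_tracial_state M \<tau> \<longleftrightarrow>
     (\<forall>x\<in>M. \<forall>y\<in>M. \<forall>c. \<tau> (\<lambda>v. c *\<^sub>C x v + y v) = c * \<tau> x + \<tau> y)
     \<and> (\<forall>x\<in>M. \<tau> (cadjoint x \<circ> x) \<in> \<real>\<^sub>\<ge>\<^sub>0)
     \<and> \<tau> id = 1
     \<and> (\<forall>x\<in>M. \<forall>y\<in>M. \<tau> (x \<circ> y) = \<tau> (y \<circ> x))
     \<and> (\<forall>x\<in>M. \<tau> (cadjoint x \<circ> x) = 0 \<longrightarrow> x = (\<lambda>_. 0))
     \<and> \<tau> \<in> predual M"

text \<open>The underlying Hilbert space is \<open>L\<^sup>2(M, \<tau>)\<close>: up to unitary equivalence, the completion of
  \<open>M\<close> for \<open>\<langle>x, y\<rangle> = \<tau> (x\<^sup>* y)\<close> with \<open>M\<close> acting by left multiplication. Here \<open>\<Lambda>\<close> is the canonical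
  dense embedding of \<open>M\<close>.\<close>

definition acts_on_L2 ::
    "('k::chilbert_space \<Rightarrow> 'k) set \<Rightarrow> (('k \<Rightarrow> 'k) \<Rightarrow> complex) \<Rightarrow> bool" where
  "acts_on_L2 M \<tau> \<longleftrightarrow> (\<exists>\<Lambda> :: ('k \<Rightarrow> 'k) \<Rightarrow> 'k.
     (\<forall>x\<in>M. \<forall>y\<in>M. \<forall>c. \<Lambda> (\<lambda>v. c *\<^sub>C x v + y v) = c *\<^sub>C \<Lambda> x + \<Lambda> y)
     \<and> (\<forall>x\<in>M. \<forall>y\<in>M. cinner (\<Lambda> x) (\<Lambda> y) = \<tau> (cadjoint x \<circ> y))
     \<and> closure (\<Lambda> ` M) = UNIV
     \<and> (\<forall>x\<in>M. \<forall>y\<in>M. x (\<Lambda> y) = \<Lambda> (x \<circ> y)))"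

definition unitary_group :: "('k::chilbert_space \<Rightarrow> 'k) set \<Rightarrow> ('k \<Rightarrow> 'k) monoid" where
  "unitary_group M = \<lparr>carrier = {u\<in>M. cadjoint u \<circ> u = id \<and> u \<circ> cadjoint u = id},
     mult = (\<circ>), one = id\<rparr>"

text \<open>The strong operator topology is the topology of pointwise norm convergence.\<close>

definition sot_on :: "('k::chilbert_space \<Rightarrow> 'k) set \<Rightarrow> ('k \<Rightarrow> 'k) topology" where
  "sot_on S = subtopology (product_topology (\<lambda>_. euclidean) UNIV) S"

definition closed_subgroup_embedding ::
    "('g, 'b) monoid_scheme \<Rightarrow> ('g \<Rightarrow> 'h::chilbert_space \<Rightarrow> 'h) \<Rightarrow>
     ('k::chilbert_space \<Rightarrow> 'k) set \<Rightarrow> ('h \<times> 'g \<Rightarrow> 'k \<Rightarrow> 'k) \<Rightarrow> bool" where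
  "closed_subgroup_embedding \<Gamma> \<pi> M \<alpha> \<longleftrightarrow>
     (let R = \<alpha> ` carrier (semidirect \<Gamma> \<pi>) in
        subgroup R (unitary_group M)
        \<and> closedin (sot_on (carrier (unitary_group M))) R
        \<and> \<alpha> \<in> iso (semidirect \<Gamma> \<pi>) (unitary_group M\<lparr>carrier := R\<rparr>)
        \<and> homeomorphic_map (prod_topology euclidean (discrete_topology (carrier \<Gamma>))) (sot_on R) \<alpha>)"

definition translation_algebra ::
    "('g, 'b) monoid_scheme \<Rightarrow> ('h \<times> 'g \<Rightarrow> 'k::chilbert_space \<Rightarrow> 'k) \<Rightarrow> ('k \<Rightarrow> 'k) set" where
  "translation_algebra \<Gamma> \<alpha> = commutant (commutant (range (\<lambda>\<xi>. \<alpha> (\<xi>, \<one>\<^bsub>\<Gamma>\<^esub>))))"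


section \<open>Unbounded operators, given by their graphs\<close>

definition adjoint_graph :: "('k::chilbert_space \<times> 'k) set \<Rightarrow> ('k \<times> 'k) set" where
  "adjoint_graph S = {(x, y). \<forall>(u, v)\<in>S. cinner v x = cinner u y}"

text \<open>The adjoint graph of a densely defined operator is always a single-valued closed linear
  subspace, so linearity of \<open>S\<close> is implied.\<close>

definition selfadjoint :: "('k::chilbert_space \<times> 'k) set \<Rightarrow> bool" where
  "selfadjoint S \<longleftrightarrow> closure (Domain S) = UNIV \<and> adjoint_graph S = S"

definition affiliated :: "('k::chilbert_space \<times> 'k) set \<Rightarrow> ('k \<Rightarrow> 'k) set \<Rightarrow> bool" where
  "affiliated S M \<longleftrightarrow>
     (\<forall>u\<in>carrier (unitary_group (commutant M)). (\<lambda>(x, y). (u x, u y)) ` S = S)"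

text \<open>\<open>U t = exp (i t S)\<close> for all real \<open>t\<close>, in the sense of Stone's theorem: \<open>U\<close> is the strongly
  continuous one-parameter unitary group with generator \<open>i S\<close>.\<close>

definition is_exp_i ::
    "('k::chilbert_space \<times> 'k) set \<Rightarrow> (real \<Rightarrow> 'k \<Rightarrow> 'k) \<Rightarrow> bool" where
  "is_exp_i S U \<longleftrightarrow>
     (\<forall>t. U t \<in> carrier (unitary_group {f. bounded_clinear f}))
     \<and> U 0 = id \<and> (\<forall>s t. U (s + t) = U s \<circ> U t)
     \<and> (\<forall>x. continuous_on UNIV (\<lambda>t. U t x))
     \<and> S = {(x, y). ((\<lambda>t. (U t x - x) /\<^sub>R t) \<longlongrightarrow> \<i> *\<^sub>C y) (at 0)}"


section \<open>Function spaces over a probability space\<close>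

definition Linfty :: "'x measure \<Rightarrow> ('x \<Rightarrow> complex) set" where
  "Linfty m = {h \<in> borel_measurable m. \<exists>C. AE x in m. cmod (h x) \<le> C}"

text \<open>Elements of \<open>L\<^sup>0\<close> and \<open>L\<^sup>\<infinity>\<close> are represented by functions, equality being equality almost
  everywhere. \<open>\<Phi>\<close> is a trace-preserving *-isomorphism from \<open>A\<close> onto \<open>L\<^sup>\<infinity>(X, m)\<close>.\<close>

definition Linfty_identification ::
    "('k::chilbert_space \<Rightarrow> 'k) set \<Rightarrow> (('k \<Rightarrow> 'k) \<Rightarrow> complex) \<Rightarrow> 'x measure \<Rightarrow>
     (('k \<Rightarrow> 'k) \<Rightarrow> 'x \<Rightarrow> complex) \<Rightarrow> bool" where
  "Linfty_identification A \<tau> m \<Phi> \<longleftrightarrow>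
     (\<forall>a\<in>A. \<Phi> a \<in> Linfty m)
     \<and> (\<forall>a\<in>A. \<forall>b\<in>A. \<forall>c. AE x in m. \<Phi> (\<lambda>v. c *\<^sub>C a v + b v) x = c * \<Phi> a x + \<Phi> b x)
     \<and> (\<forall>a\<in>A. \<forall>b\<in>A. AE x in m. \<Phi> (a \<circ> b) x = \<Phi> a x * \<Phi> b x)
     \<and> (\<forall>a\<in>A. AE x in m. \<Phi> (cadjoint a) x = cnj (\<Phi> a x))
     \<and> (\<forall>a\<in>A. \<forall>b\<in>A. (AE x in m. \<Phi> a x = \<Phi> b x) \<longrightarrow> a = b)
     \<and> (\<forall>h\<in>Linfty m. \<exists>a\<in>A. AE x in m. \<Phi> a x = h x)
     \<and> (\<forall>a\<in>A. \<tau> a = (\<integral>x. \<Phi> a x \<partial>m))"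

text \<open>The closed densely defined operator affiliated with \<open>A\<close> that corresponds to \<open>f \<in> L\<^sup>0(X, m)\<close>:
  with \<open>a n\<close> the bounded operator corresponding to the truncation of \<open>f\<close> to \<open>{\<bar>f\<bar> \<le> n}\<close>, a vector
  \<open>v\<close> is in the domain iff \<open>a n v\<close> converges, and the limit is the value at \<open>v\<close>.\<close>

definition affiliated_op ::
    "('k::chilbert_space \<Rightarrow> 'k) set \<Rightarrow> 'x measure \<Rightarrow> (('k \<Rightarrow> 'k) \<Rightarrow> 'x \<Rightarrow> complex) \<Rightarrow>
     ('x \<Rightarrow> complex) \<Rightarrow> ('k \<times> 'k) set" where
  "affiliated_op A m \<Phi> f = {(v, w). \<exists>a :: nat \<Rightarrow> 'k \<Rightarrow> 'k.
     (\<forall>n. a n \<in> A \<and> (AE x in m. \<Phi> (a n) x = (if cmod (f x) \<le> real n then f x else 0)))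
     \<and> (\<lambda>n. a n v) \<longlonglongrightarrow> w}"

definition L2_real :: "'x measure \<Rightarrow> ('x \<Rightarrow> real) set" where
  "L2_real m = {h \<in> borel_measurable m. integrable m (\<lambda>x. (h x)\<^sup>2)}"

definition measure_preserving_action ::
    "('g, 'b) monoid_scheme \<Rightarrow> 'x measure \<Rightarrow> ('g \<Rightarrow> 'x \<Rightarrow> 'x) \<Rightarrow> bool" where
  "measure_preserving_action \<Gamma> m act \<longleftrightarrow> group_action \<Gamma> (space m) act \<and>
     (\<forall>s\<in>carrier \<Gamma>. act s \<in> measurable m m \<and> distr m m (act s) = m)"

definition translate ::
    "('g, 'b) monoid_scheme \<Rightarrow> ('g \<Rightarrow> 'x \<Rightarrow> 'x) \<Rightarrow> 'g \<Rightarrow> ('x \<Rightarrow> 'c) \<Rightarrow> 'x \<Rightarrow> 'c" where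
  "translate \<Gamma> act s h = (\<lambda>x. h (act (inv\<^bsub>\<Gamma>\<^esub> s) x))"

end

theory Submission
  imports Defs
begin

text \<open>The trace vector \<open>\<Omega>\<close> turns the strong operator topology on \<open>\<A>\<close> into the \<open>L\<^sup>2\<close> norm, so the
  identity \<open>\<alpha>(t\<xi>) = exp (i t T\<xi>)\<close> holds between functions on \<open>X\<close>, and \<open>T\<close> is a linear, equivariant
  map \<open>H \<rightarrow> L\<^sup>0\<close> that is continuous at 0. Let \<open>q\<close> be the square of the \<open>\<Gamma>\<close>-invariant norm
  \<open>sup\<^sub>s \<parallel>\<pi>(s)\<xi>\<parallel>\<close>. Averaging over random signs shows that the \<open>\<Gamma>\<close>-invariant convex set \<open>K\<close> of
  functions \<open>\<Sum>\<^sub>i (T\<xi>\<^sub>i)\<^sup>2\<close> with \<open>\<Sum>\<^sub>i q(\<xi>\<^sub>i) \<le> 1\<close> is bounded in \<open>L\<^sup>0\<close>. The functional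
  \<open>k \<mapsto> \<integral> 1 / (1 + k)\<close> is strictly convex, so along any minimising sequence in \<open>K\<close> the functions
  \<open>1 / (1 + k)\<close> converge to one and the same limit \<open>g\<close>. By uniqueness \<open>g\<close> is \<open>\<Gamma>\<close>-invariant, by
  boundedness in \<open>L\<^sup>0\<close> it is positive, and the first variation at the minimum reads
  \<open>\<integral> g\<^sup>2 k \<le> 1\<close> for all \<open>k \<in> K\<close>. A multiple of \<open>g\<^sup>2\<close> is the required weight.\<close>

section \<open>Riesz representation and adjoints\<close>

lemma cinner_add_left: "cinner (x + y) z = cinner x z + cinner y (z :: 'a::chilbert_space)"
  by (metis cinner_add_right cinner_commute complex_cnj_add)

lemma cinner_scaleC_left: "cinner (c *\<^sub>C x) y = cnj c * cinner x (y :: 'a::chilbert_space)"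
  by (metis cinner_commute cinner_scaleC_right complex_cnj_mult)

lemma cinner_scaleR_right: "cinner x (r *\<^sub>R y) = of_real r * cinner x (y :: 'a::chilbert_space)"
  by (metis cinner_scaleC_right scaleC_of_real)

lemma cinner_minus_right: "cinner x (- y) = - cinner x (y :: 'a::chilbert_space)"
  using cinner_scaleR_right[of x "-1" y] by simp

lemma cinner_diff_right: "cinner x (y - z) = cinner x y - cinner x (z :: 'a::chilbert_space)"
  using cinner_add_right[of x y "-z"] by (simp add: cinner_minus_right)

lemma scaleC_minus_left: "(- c) *\<^sub>C x = - (c *\<^sub>C (x :: 'a::chilbert_space))"
  using scaleC_add_left[of "- c" c x] scaleC_of_real[of 0 x] by (simp add: eq_neg_iff_add_eq_0)

lemma norm_scaleC: "norm (c *\<^sub>C x) = cmod c * norm (x :: 'a::chilbert_space)"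
proof -
  have "complex_of_real ((norm (c *\<^sub>C x))\<^sup>2) = complex_of_real ((cmod c * norm x)\<^sup>2)"
    unfolding cinner_self[symmetric] cinner_scaleC_left cinner_scaleC_right
    by (simp add: cinner_self power_mult_distrib complex_norm_square[unfolded of_real_power] ac_simps)
  then show ?thesis
    by (metis norm_ge_zero mult_nonneg_nonneg of_real_eq_iff power2_eq_imp_eq)
qed

lemma norm_add_sq:
  "(norm (x + y))\<^sup>2 = (norm x)\<^sup>2 + 2 * Re (cinner x y) + (norm (y :: 'a::chilbert_space))\<^sup>2"
proof -
  have "complex_of_real ((norm (x + y))\<^sup>2) = of_real ((norm x)\<^sup>2) + (cinner x y + cnj (cinner x y)) + of_real ((norm y)\<^sup>2)"
    unfolding cinner_self[symmetric] by (simp add: cinner_add_left cinner_add_right cinner_commute[of y x])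
  from arg_cong[OF this, of Re] show ?thesis by simp
qed

lemma parallelogram_chilbert:
  "(norm (x + y))\<^sup>2 + (norm (x - y))\<^sup>2 = 2 * (norm x)\<^sup>2 + 2 * (norm (y :: 'a::chilbert_space))\<^sup>2"
  using norm_add_sq[of x y] norm_add_sq[of x "- y"] by (simp add: cinner_minus_right)

text \<open>The class provides the norm with its triangle inequality, and squaring that inequality
  bounds the real part; multiplying \<open>y\<close> by the phase \<open>c\<close> makes the inner
  product real and non-negative.\<close>

lemma cinner_Cauchy_Schwarz: "cmod (cinner x y) \<le> norm x * norm (y :: 'a::chilbert_space)"
proof -
  have re: "Re (cinner x z) \<le> norm x * norm z" for z
    using norm_add_sq[of x z] power_mono[OF norm_triangle_ineq[of x z], of 2]
    by (simp add: power2_sum)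
  define c where "c = (if cinner x y = 0 then 1 else cnj (cinner x y) / cmod (cinner x y))"
  have c: "cmod c = 1" "c * cinner x y = cmod (cinner x y)"
    using complex_norm_square[of "cinner x y"]
    by (auto simp: c_def norm_divide power2_eq_square mult.commute divide_eq_eq)
  have "cmod (cinner x y) = Re (cinner x (c *\<^sub>C y))"
    by (simp add: cinner_scaleC_right c)
  also have "\<dots> \<le> norm x * norm y"
    using re[of "c *\<^sub>C y"] by (simp add: norm_scaleC c)
  finally show ?thesis .
qed

lemma cinner_ext: "(\<And>x. cinner x y = cinner x z) \<Longrightarrow> y = (z :: 'a::chilbert_space)"
  using cinner_self[of "y - z"] by (simp add: cinner_diff_right)

text \<open>The representing vector minimises \<open>J\<close>: if \<open>l = cinner z\<close>, then
  \<open>J x\<close> is the square of \<open>norm (x - z)\<close> minus that of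
  \<open>norm z\<close>. A minimising sequence is Cauchy, and the vanishing first variation at its
  limit is the claim.\<close>

lemma Riesz_representation:
  fixes l :: "'a::chilbert_space \<Rightarrow> complex"
  assumes add: "\<And>x y. l (x + y) = l x + l y" and scale: "\<And>c x. l (c *\<^sub>C x) = c * l x"
    and bound: "\<And>x. cmod (l x) \<le> B * norm x"
  shows "\<exists>z. \<forall>x. l x = cinner z x"
proof -
  define J where "J x = (norm x)\<^sup>2 - 2 * Re (l x)" for x
  define I where "I = (INF x. J x)"
  have Jlow: "J x \<ge> - B\<^sup>2" for x
  proof -
    have "2 * Re (l x) \<le> 2 * norm x * B"
      using bound[of x] complex_Re_le_cmod[of "l x"] by (simp add: mult.commute)
    moreover have "0 \<le> (norm x - B)\<^sup>2" by simp
    ultimately show ?thesis by (simp add: J_def power2_diff)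
  qed
  then have bdd: "bdd_below (range J)" by (intro bdd_belowI2)
  then have IJ: "I \<le> J x" for x by (auto simp: I_def intro: cINF_lower)
  have lR: "l (r *\<^sub>R x) = of_real r * l x" for r x
    using scale[of "of_real r" x] by (simp add: scaleC_of_real)
  have "\<exists>x. J x < I + 1 / Suc n" for n
    unfolding I_def using cINF_less_iff[OF _ bdd, of "I + 1 / Suc n"] by (simp add: I_def)
  then obtain x where x: "\<And>n. J (x n) < I + 1 / Suc n" by metis
  \<comment> \<open>The parallelogram law combined with \<open>I \<le> J\<close> at the midpoint:
    two vectors that nearly minimise \<open>J\<close> are close to each other.\<close>
  have mid: "(norm (u - v))\<^sup>2 \<le> 2 * (J u - I) + 2 * (J v - I)" for u v
  proof -
    have "J ((1/2) *\<^sub>R (u + v)) = (norm (u + v))\<^sup>2 / 4 - Re (l u) - Re (l v)"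
      unfolding J_def lR add norm_scaleR by (simp add: power_divide add_divide_distrib)
    then show ?thesis
      using parallelogram_chilbert[of u v] IJ[of "(1/2) *\<^sub>R (u + v)"] by (simp add: J_def)
  qed
  have "Cauchy x"
  proof (rule metric_CauchyI)
    fix e :: real assume e: "e > 0"
    obtain N :: nat where N: "1 / Suc N < e\<^sup>2 / 4"
      using nat_approx_posE[of "e\<^sup>2/4"] e by (metis half_gt_zero zero_less_power divide_pos_pos zero_less_numeral of_nat_Suc)
    have "dist (x i) (x j) < e" if "i \<ge> N" "j \<ge> N" for i j
    proof -
      have "J (x k) - I < e\<^sup>2 / 4" if "k \<ge> N" for k
      proof -
        have "1 / real (Suc k) \<le> 1 / Suc N" using that by (intro divide_left_mono) auto
        then show ?thesis using x[of k] N by linarith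
      qed
      from this[OF that(1)] this[OF that(2)] have "2 * (J (x i) - I) + 2 * (J (x j) - I) < e\<^sup>2"
        by simp
      then have "(norm (x i - x j))\<^sup>2 < e\<^sup>2"
        using mid[of "x i" "x j"] by simp
      then show ?thesis using e by (simp add: dist_norm power2_less_imp_less)
    qed
    then show "\<exists>M. \<forall>i\<ge>M. \<forall>j\<ge>M. dist (x i) (x j) < e" by blast
  qed
  then obtain z where z: "x \<longlonglongrightarrow> z" using Cauchy_convergent_iff convergent_def by blast
  have "bounded_linear l"
    by (rule bounded_linear_intro[of _ B]) (use add lR bound in \<open>auto simp: scaleR_conv_of_real mult.commute\<close>)
  then have "(\<lambda>n. l (x n)) \<longlonglongrightarrow> l z" using z bounded_linear.tendsto by blast
  then have "(\<lambda>n. J (x n)) \<longlonglongrightarrow> J z" unfolding J_def by (intro tendsto_intros z)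
  moreover have "(\<lambda>n. I + 1 / Suc n) \<longlonglongrightarrow> I + 0"
    by (intro tendsto_intros LIMSEQ_Suc[OF lim_const_over_n])
  ultimately have "J z \<le> I + 0"
    by (rule LIMSEQ_le) (use x in \<open>auto intro: less_imp_le\<close>)
  then have Jz: "J z \<le> J v" for v using IJ[of v] by linarith
  have re: "Re (cinner z v - l v) = 0" for v
  proof -
    define b where "b = Re (cinner z v - l v)"
    have q: "0 \<le> t\<^sup>2 * (norm v)\<^sup>2 + 2 * t * b" for t :: real
      using Jz[of "z + t *\<^sub>R v"] norm_add_sq[of z "t *\<^sub>R v"]
      by (simp add: J_def add lR cinner_scaleR_right b_def algebra_simps power_mult_distrib)
    \<comment> \<open>The parabola in \<open>q\<close> would be lowest at
      \<open>t = - b / (norm v)\<^sup>2\<close>; the added 1 keeps the denominator nonzero for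
      \<open>v = 0\<close> and still forces \<open>b = 0\<close>.\<close>
    have "0 \<le> (b / (1 + (norm v)\<^sup>2))\<^sup>2 * (norm v)\<^sup>2 - 2 * (b / (1 + (norm v)\<^sup>2)) * b"
      using q[of "- b / (1 + (norm v)\<^sup>2)"] by simp
    also have "\<dots> = b\<^sup>2 * ((norm v)\<^sup>2 - 2 * (1 + (norm v)\<^sup>2)) / (1 + (norm v)\<^sup>2)\<^sup>2"
      by (simp add: field_simps power2_eq_square add_nonneg_eq_0_iff add_pos_nonneg)
    finally have "0 \<le> b\<^sup>2 * ((norm v)\<^sup>2 - 2 * (1 + (norm v)\<^sup>2))"
      using add_pos_nonneg[of 1 "(norm v)\<^sup>2"]
      by (metis divide_less_0_iff not_le zero_less_one zero_le_power2 zero_less_power)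
    moreover have "b\<^sup>2 * (norm v)\<^sup>2 \<ge> 0" by simp
    ultimately have "b\<^sup>2 \<le> 0" unfolding right_diff_distrib distrib_left by linarith
    then show ?thesis by (simp add: b_def)
  qed
  \<comment> \<open>The real part at \<open>\<i> *\<^sub>C v\<close> is minus the imaginary part at
    \<open>v\<close>.\<close>
  have "l v = cinner z v" for v
    using re[of v] re[of "\<i> *\<^sub>C v"] by (auto simp: scale cinner_scaleC_right complex_eq_iff)
  then show ?thesis by blast
qed

text \<open>\<open>cadjoint\<close> is a definite description, so all its properties rest on this.
  Existence is the Riesz theorem for the functional that sends \<open>x\<close> to
  \<open>cinner y (f x)\<close>.\<close>

lemma cadjoint_ex1:
  assumes f: "bounded_clinear f"
  shows "\<exists>!g. \<forall>x y. cinner (f x) y = cinner x (g y)"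
proof -
  from f have bl: "bounded_linear f" by (simp add: bounded_clinear_def)
  obtain B where B: "\<And>x. norm (f x) \<le> norm x * B"
    using bounded_linear.bounded[OF bl] by blast
  have "\<exists>z. \<forall>x. cinner y (f x) = cinner z x" for y
  proof (rule Riesz_representation)
    fix x x' c
    show "cinner y (f (x + x')) = cinner y (f x) + cinner y (f x')"
      by (simp add: linear_add[OF bounded_linear.linear[OF bl]] cinner_add_right)
    show "cinner y (f (c *\<^sub>C x)) = c * cinner y (f x)"
      using f by (simp add: bounded_clinear_def cinner_scaleC_right)
    show "cmod (cinner y (f x)) \<le> (norm y * B) * norm x"
      using cinner_Cauchy_Schwarz[of y "f x"] mult_left_mono[OF B[of x] norm_ge_zero[of y]]
      by (simp add: ac_simps)
  qed
  then obtain g where g: "\<And>x y. cinner y (f x) = cinner (g y) x" by metis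
  show ?thesis
  proof (rule ex1I[of _ g])
    show "\<forall>x y. cinner (f x) y = cinner x (g y)" using g cinner_commute by metis
    show "h = g" if "\<forall>x y. cinner (f x) y = cinner x (h y)" for h
      by (rule ext, rule cinner_ext) (metis that g cinner_commute)
  qed
qed

lemma cadjoint:
  "bounded_clinear f \<Longrightarrow> cinner (f x) y = cinner x (cadjoint f y)"
  using theI'[OF cadjoint_ex1, of f] unfolding cadjoint_def by blast

lemma bounded_clinear_cadjoint:
  assumes f: "bounded_clinear f"
  shows "bounded_clinear (cadjoint f)"
proof -
  have add: "cadjoint f (x + y) = cadjoint f x + cadjoint f y" for x y
    by (rule cinner_ext) (simp add: cadjoint[OF f, symmetric] cinner_add_right)
  have sc: "cadjoint f (c *\<^sub>C x) = c *\<^sub>C cadjoint f x" for c x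
    by (rule cinner_ext) (simp add: cadjoint[OF f, symmetric] cinner_scaleC_right)
  obtain B where B: "\<And>x. norm (f x) \<le> norm x * B" "B > 0"
    using bounded_linear.pos_bounded f unfolding bounded_clinear_def by metis
  have "norm (cadjoint f y) \<le> norm y * B" for y
  proof -
    have "(norm (cadjoint f y))\<^sup>2 = cmod (cinner (f (cadjoint f y)) y)"
      by (simp add: cadjoint[OF f] cinner_self norm_power)
    also have "\<dots> \<le> norm (cadjoint f y) * B * norm y"
      using cinner_Cauchy_Schwarz[of "f (cadjoint f y)" y] B(1)[of "cadjoint f y"]
      by (meson mult_right_mono norm_ge_zero order_trans)
    finally show ?thesis
      using B(2) by (cases "cadjoint f y = 0") (auto simp: power2_eq_square mult.assoc mult.commute[of B])
  qed
  then have "bounded_linear (cadjoint f)"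
    by (intro bounded_linear_intro[of _ B]) (use add sc scaleC_of_real in metis)+
  then show ?thesis using sc by (simp add: bounded_clinear_def)
qed

section \<open>Algebra of bounded operators and of commutants\<close>

lemma bounded_clinear_id: "bounded_clinear id"
  by (simp add: bounded_clinear_def id_def bounded_linear_ident)

lemma bounded_clinear_comp:
  "bounded_clinear f \<Longrightarrow> bounded_clinear g \<Longrightarrow> bounded_clinear (f \<circ> g)"
  unfolding bounded_clinear_def comp_def using bounded_linear_compose by auto

lemma bounded_clinear_lincomb:
  assumes "bounded_clinear f" "bounded_clinear g"
  shows "bounded_clinear (\<lambda>v. c *\<^sub>C f v + g v)"
proof -
  have "bounded_linear (\<lambda>v :: 'b. c *\<^sub>C v)"
  proof (rule bounded_linear_intro[of _ "cmod c"])
    show "c *\<^sub>C (r *\<^sub>R v) = r *\<^sub>R (c *\<^sub>C v)" for r and v :: 'b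
      by (metis scaleC_of_real scaleC_scaleC mult.commute)
  qed (auto simp: scaleC_add_right norm_scaleC)
  then have "bounded_linear (\<lambda>v. c *\<^sub>C f v + g v)"
    using assms unfolding bounded_clinear_def
    by (intro bounded_linear_add) (auto intro: bounded_linear_compose)
  then show ?thesis
    using assms by (simp add: bounded_clinear_def scaleC_add_right scaleC_scaleC mult.commute)
qed

lemma commutantD:
  assumes "x \<in> commutant S"
  shows "bounded_clinear x" "y \<in> S \<Longrightarrow> x \<circ> y = y \<circ> x"
  using assms by (auto simp: commutant_def)

lemma commutant_antimono: "S \<subseteq> S' \<Longrightarrow> commutant S' \<subseteq> commutant S"
  by (auto simp: commutant_def)

lemma subset_double_commutant:
  "(\<And>x. x \<in> S \<Longrightarrow> bounded_clinear x) \<Longrightarrow> S \<subseteq> commutant (commutant S)"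
  by (auto simp: commutant_def)

lemma id_in_commutant: "id \<in> commutant S"
  by (simp add: commutant_def bounded_clinear_id)

lemma comp_in_commutant:
  assumes "x \<in> commutant S" "y \<in> commutant S"
  shows "x \<circ> y \<in> commutant S"
proof -
  have "(x \<circ> y) \<circ> z = z \<circ> (x \<circ> y)" if "z \<in> S" for z
    using commutantD(2)[OF assms(1) that] commutantD(2)[OF assms(2) that]
    by (simp add: fun_eq_iff)
  then show ?thesis
    using assms bounded_clinear_comp by (auto simp: commutant_def)
qed

lemma lincomb_in_commutant:
  assumes S: "\<And>z. z \<in> S \<Longrightarrow> bounded_clinear z" and "x \<in> commutant S" "y \<in> commutant S"
  shows "(\<lambda>v. c *\<^sub>C x v + y v) \<in> commutant S"
proof -
  have "(\<lambda>v. c *\<^sub>C x v + y v) \<circ> z = z \<circ> (\<lambda>v. c *\<^sub>C x v + y v)" if "z \<in> S" for z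
  proof -
    have "linear z" "\<And>v. z (c *\<^sub>C v) = c *\<^sub>C z v"
      using S[OF that] by (auto simp: bounded_clinear_def bounded_linear.linear)
    then show ?thesis
      using commutantD(2)[OF assms(2) that] commutantD(2)[OF assms(3) that]
      by (simp add: fun_eq_iff linear_add)
  qed
  then show ?thesis
    using assms bounded_clinear_lincomb by (auto simp: commutant_def)
qed

text \<open>Take adjoints in the identity that says that \<open>x\<close> commutes with
  \<open>cadjoint z\<close>; closure of \<open>S\<close> under adjoints enters here.\<close>

lemma cadjoint_in_commutant:
  assumes S: "\<And>z. z \<in> S \<Longrightarrow> bounded_clinear z \<and> cadjoint z \<in> S" and x: "x \<in> commutant S"
  shows "cadjoint x \<in> commutant S"
proof -
  have bx: "bounded_clinear x" using commutantD(1)[OF x] .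
  have "cadjoint x \<circ> z = z \<circ> cadjoint x" if z: "z \<in> S" for z
  proof
    fix y
    have bz: "bounded_clinear z" "bounded_clinear (cadjoint z)"
      using S[OF z] bounded_clinear_cadjoint by auto
    have c: "x (cadjoint z v) = cadjoint z (x v)" for v
      using commutantD(2)[OF x, of "cadjoint z"] S[OF z] by (simp add: fun_eq_iff)
    have zz: "cinner (cadjoint z v) w = cinner v (z w)" for v w
      using cadjoint[OF bz(1), of w v] cinner_commute by metis
    show "(cadjoint x \<circ> z) y = (z \<circ> cadjoint x) y"
      by (rule cinner_ext) (simp add: cadjoint[OF bx, symmetric] zz[symmetric] c)
  qed
  then show ?thesis using bounded_clinear_cadjoint[OF bx] by (simp add: commutant_def)
qed

section \<open>An invariant weight for a convex set bounded in measure\<close>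

text \<open>Members of \<open>K\<close> need not be integrable. The substitute \<open>r k\<close>
  has values in (0, 1], so its integrals exist and dominated convergence works with the constant
  1.\<close>

lemma (in prob_space) invariant_weight:
  fixes K :: "('a \<Rightarrow> real) set" and G :: "('a \<Rightarrow> 'a) set"
  assumes ne: "K \<noteq> {}" and meas: "\<And>k. k \<in> K \<Longrightarrow> k \<in> borel_measurable M"
    and pos: "\<And>k x. k \<in> K \<Longrightarrow> 0 \<le> k x"
    and conv: "\<And>k k' t. k \<in> K \<Longrightarrow> k' \<in> K \<Longrightarrow> 0 < t \<Longrightarrow> t < 1 \<Longrightarrow> (\<lambda>x. (1 - t) * k x + t * k' x) \<in> K"
    and tight: "\<And>e. e > 0 \<Longrightarrow> \<exists>R. \<forall>k\<in>K. prob {x\<in>space M. k x > R} \<le> e"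
    and G: "\<And>\<theta>. \<theta> \<in> G \<Longrightarrow> \<theta> \<in> measurable M M \<and> distr M M \<theta> = M"
    and inv: "\<And>\<theta> k. \<theta> \<in> G \<Longrightarrow> k \<in> K \<Longrightarrow> k \<circ> \<theta> \<in> K"
  shows "\<exists>g. g \<in> borel_measurable M \<and> (AE x in M. 0 < g x) \<and>
     (\<forall>\<theta>\<in>G. AE x in M. g (\<theta> x) = g x) \<and>
     (\<forall>k\<in>K. integrable M (\<lambda>x. (g x)\<^sup>2 * k x) \<and> (\<integral>x. (g x)\<^sup>2 * k x \<partial>M) \<le> 1)"
proof -

  \<comment> \<open>Quantitative strict convexity of the functional\<close>
  define r where "r k x = 1 / (1 + k x :: real)" for k :: "'a \<Rightarrow> real" and x
  define I where "I = (INF k\<in>K. \<integral>x. r k x \<partial>M)"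
  have r_meas [measurable]: "r k \<in> borel_measurable M" if "k \<in> K" for k
    using meas[OF that] unfolding r_def by measurable
  have r_bd: "0 < r k x" "r k x \<le> 1" if "k \<in> K" for k x
    using pos[OF that, of x] by (auto simp: r_def)
  have r_int: "integrable M (r k)" if "k \<in> K" for k
    by (rule integrable_const_bound[of _ 1]) (use r_bd[OF that] r_meas[OF that] in \<open>auto simp: less_imp_le\<close>)
  have bdd: "bdd_below ((\<lambda>k. \<integral>x. r k x \<partial>M) ` K)"
    by (rule bdd_belowI[of _ 0]) (use r_bd(1)[THEN less_imp_le] in \<open>auto intro!: integral_nonneg_AE\<close>)
  have I_le: "I \<le> (\<integral>x. r k x \<partial>M)" if "k \<in> K" for k
    unfolding I_def by (rule cINF_lower[OF bdd that])
  \<comment> \<open>Near-minimisers have close \<open>r\<close> in L1. By strict convexity the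
    squared distance is at most the convexity gap at the midpoint, whose integral is controlled
    because the midpoint lies in \<open>K\<close> and so has integral at least \<open>I\<close>. The
    free parameter \<open>e\<close> passes from squares to absolute values.\<close>
  have L1: "(\<integral>x. \<bar>r k x - r k' x\<bar> \<partial>M) \<le>
      e / 4 + 2 * ((\<integral>x. r k x \<partial>M) - I + ((\<integral>x. r k' x \<partial>M) - I)) / e"
    if k: "k \<in> K" "k' \<in> K" and e: "e > 0" for k k' e
  proof -
    let ?m = "\<lambda>x. (1 - 1/2) * k x + 1/2 * k' x"
    have m: "?m \<in> K" using conv[OF k, of "1/2"] by simp
    have pw: "\<bar>r k x - r k' x\<bar> \<le> e / 4 + (2 * r k x + 2 * r k' x - 4 * r ?m x) / e" for x
    proof -
      define a where "a = 1 + k x"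
      define b where "b = 1 + k' x"
      have ab: "a \<ge> 1" "b \<ge> 1" using pos k by (auto simp: a_def b_def)
      have rm: "r ?m x = 2 / (a + b)" using ab by (simp add: r_def a_def b_def field_simps)
      have rr: "r k x = 1 / a" "r k' x = 1 / b" by (auto simp: r_def a_def b_def)
      \<comment> \<open>The factorisation displays the sign: \<open>a \<ge> 1\<close> and
        \<open>b \<ge> 1\<close> give \<open>2 * a * b \<ge> a + b\<close>.\<close>
      have "2 / a + 2 / b - 4 * (2 / (a + b)) - (1 / a - 1 / b)\<^sup>2
          = (a - b)\<^sup>2 * (2 * a * b - (a + b)) / (a\<^sup>2 * b\<^sup>2 * (a + b))"
        using ab by (simp add: divide_simps power2_eq_square) (simp add: algebra_simps)
      moreover have "1 * b \<le> a * b" "a * 1 \<le> a * b"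
        using ab by (auto intro!: mult_right_mono mult_left_mono)
      then have "2 * a * b - (a + b) \<ge> 0" by simp
      ultimately have sq: "(1 / a - 1 / b)\<^sup>2 \<le> 2 / a + 2 / b - 4 * (2 / (a + b))"
        using ab by (smt (verit) divide_nonneg_nonneg mult_nonneg_nonneg zero_le_power2)
      have "0 \<le> (\<bar>1 / a - 1 / b\<bar> - e / 2)\<^sup>2" by simp
      then have "\<bar>1 / a - 1 / b\<bar> * e \<le> e\<^sup>2 / 4 + (1 / a - 1 / b)\<^sup>2"
        by (simp add: power2_diff power_divide)
      also have "\<dots> \<le> e\<^sup>2 / 4 + (2 / a + 2 / b - 4 * (2 / (a + b)))" using sq by simp
      finally have "\<bar>1 / a - 1 / b\<bar> \<le> (e\<^sup>2 / 4 + (2 / a + 2 / b - 4 * (2 / (a + b)))) / e"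
        using e by (simp add: pos_le_divide_eq)
      also have "\<dots> = e / 4 + (2 / a + 2 / b - 4 * (2 / (a + b))) / e"
        using e by (simp add: add_divide_distrib power2_eq_square)
      finally show ?thesis unfolding rm rr by simp
    qed
    have "(\<integral>x. \<bar>r k x - r k' x\<bar> \<partial>M) \<le> (\<integral>x. e / 4 + (2 * r k x + 2 * r k' x - 4 * r ?m x) / e \<partial>M)"
      by (rule integral_mono) (use r_int k m pw in \<open>auto intro!: Bochner_Integration.integrable_add
            Bochner_Integration.integrable_diff integrable_divide integrable_mult_right integrable_abs\<close>)
    also have "\<dots> = e / 4 + (2 * (\<integral>x. r k x \<partial>M) + 2 * (\<integral>x. r k' x \<partial>M) - 4 * (\<integral>x. r ?m x \<partial>M)) / e"
      using r_int[OF k(1)] r_int[OF k(2)] r_int[OF m] by (simp add: prob_space)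
    also have "\<dots> \<le> e / 4 + 2 * ((\<integral>x. r k x \<partial>M) - I + ((\<integral>x. r k' x \<partial>M) - I)) / e"
      using I_le[OF m] e by (intro add_left_mono divide_right_mono) auto
    finally show ?thesis .
  qed

  \<comment> \<open>A minimising sequence and its limit\<close>
  have "\<exists>k\<in>K. (\<integral>x. r k x \<partial>M) < I + 1 / Suc n" for n
    using cINF_less_iff[OF ne bdd, of "I + 1 / Suc n"] by (simp add: I_def)
  then obtain \<kappa>' where \<kappa>': "\<And>n. \<kappa>' n \<in> K" "\<And>n. (\<integral>x. r (\<kappa>' n) x \<partial>M) < I + 1 / Suc n" by metis
  have small: "\<exists>N. \<forall>i\<ge>N. (\<integral>x. r (\<kappa>' i) x \<partial>M) - I < e" if "e > 0" for e
  proof -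
    obtain N :: nat where N: "1 / Suc N < e"
      by (rule nat_approx_posE[OF \<open>e > 0\<close>])
    have "(\<integral>x. r (\<kappa>' i) x \<partial>M) - I < e" if "i \<ge> N" for i
    proof -
      have "1 / real (Suc i) \<le> 1 / Suc N" using that by (auto simp: frac_le)
      then show ?thesis using \<kappa>'(2)[of i] N by linarith
    qed
    then show ?thesis by blast
  qed
  obtain \<rho> where \<rho>: "strict_mono \<rho>" and Cau: "AE x in M. Cauchy (\<lambda>i. r (\<kappa>' (\<rho> i)) x)"
  proof (rule cauchy_L1_AE_cauchy_subseq[of M "\<lambda>n. r (\<kappa>' n)"])
    fix e :: real assume e: "e > 0"
    \<comment> \<open>Excesses below \<open>e\<^sup>2 / 8\<close> make the bound in
      \<open>L1\<close> at most \<open>e / 4 + e / 2\<close>, which is less than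
      \<open>e\<close>.\<close>
    obtain N where N: "\<And>i. i \<ge> N \<Longrightarrow> (\<integral>x. r (\<kappa>' i) x \<partial>M) - I < e\<^sup>2 / 8"
      using small[of "e\<^sup>2 / 8"] e by auto
    have "(LINT x|M. norm (r (\<kappa>' i) x - r (\<kappa>' j) x)) < e" if "i \<ge> N" "j \<ge> N" for i j
    proof -
      have "2 * ((\<integral>x. r (\<kappa>' i) x \<partial>M) - I + ((\<integral>x. r (\<kappa>' j) x \<partial>M) - I)) / e \<le> 2 * (e\<^sup>2 / 8 + e\<^sup>2 / 8) / e"
        using N[OF that(1)] N[OF that(2)] e by (intro divide_right_mono mult_left_mono add_mono) auto
      also have "\<dots> = e / 2" using e by (simp add: power2_eq_square)
      finally show ?thesis using L1[OF \<kappa>'(1)[of i] \<kappa>'(1)[of j] e] e unfolding real_norm_def by linarith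
    qed
    then show "\<exists>N. \<forall>i\<ge>N. \<forall>j\<ge>N. (LINT x|M. norm (r (\<kappa>' i) x - r (\<kappa>' j) x)) < e" by blast
  qed (use r_int \<kappa>'(1) in auto)
  define \<kappa> where "\<kappa> n = \<kappa>' (\<rho> n)" for n
  have \<kappa>: "\<kappa> n \<in> K" for n by (simp add: \<kappa>_def \<kappa>'(1))
  note rk = r_bd[OF \<kappa>] and [measurable] = r_meas[OF \<kappa>]
  have \<kappa>I: "(\<lambda>n. \<integral>x. r (\<kappa> n) x \<partial>M) \<longlonglongrightarrow> I"
  proof (rule LIMSEQ_I)
    fix e :: real assume "e > 0"
    then obtain N where N: "\<And>i. i \<ge> N \<Longrightarrow> (\<integral>x. r (\<kappa>' i) x \<partial>M) - I < e" using small by blast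
    have "norm ((\<integral>x. r (\<kappa> n) x \<partial>M) - I) < e" if "n \<ge> N" for n
      using N[of "\<rho> n"] I_le[OF \<kappa>[of n]] seq_suble[OF \<rho>, of n] that by (simp add: \<kappa>_def)
    then show "\<exists>N. \<forall>n\<ge>N. norm ((\<integral>x. r (\<kappa> n) x \<partial>M) - I) < e" by blast
  qed
  \<comment> \<open>On the null set of divergence \<open>lim\<close> returns an unspecified value,
    so bounds on \<open>g\<close> hold only almost everywhere.\<close>
  define g where "g x = lim (\<lambda>n. r (\<kappa> n) x)" for x
  have g_meas [measurable]: "g \<in> borel_measurable M"
    unfolding g_def by (intro borel_measurable_lim_metric) measurable
  have lim: "AE x in M. (\<lambda>n. r (\<kappa> n) x) \<longlonglongrightarrow> g x"
    using Cau by eventually_elim (simp add: g_def \<kappa>_def Cauchy_convergent_iff convergent_LIMSEQ_iff)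
  have g_bd: "AE x in M. 0 \<le> g x \<and> g x \<le> 1"
    using lim
  proof eventually_elim
    case (elim x)
    show ?case
      using LIMSEQ_le_const[OF elim, of 0] LIMSEQ_le_const2[OF elim, of 1] rk less_imp_le by blast
  qed
  have gI: "(\<integral>x. g x \<partial>M) = I"
    by (rule LIMSEQ_unique[OF _ \<kappa>I], rule integral_dominated_convergence[of _ _ _ "\<lambda>_. 1"])
      (use lim rk in \<open>auto simp: less_imp_le\<close>)
  have g_int: "integrable M g"
    by (rule integrable_const_bound[of _ 1]) (use g_bd in auto)

  \<comment> \<open>Positivity of the limit\<close>
  have g_pos: "AE x in M. 0 < g x"
  proof -
    have le: "prob {x\<in>space M. g x \<le> 0} \<le> e" if "e > 0" for e
    proof -
      obtain R' where R': "\<And>k. k \<in> K \<Longrightarrow> prob {x\<in>space M. k x > R'} \<le> e" using tight[OF \<open>e > 0\<close>] by blast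
      define R where "R = max R' 0"
      have R0: "R \<ge> 0" by (simp add: R_def)
      have R: "prob {x\<in>space M. k x > R} \<le> e" if "k \<in> K" for k
        by (rule order_trans[OF finite_measure_mono R'[OF that]]) (use meas[OF that] in \<open>auto simp: R_def\<close>)
      \<comment> \<open>A continuous substitute for an indicator, so that its integral passes to the
        limit: it is 1 at 0 and vanishes from \<open>1 / (1 + R)\<close> on, that is, on values of
        \<open>r k\<close> with \<open>k \<le> R\<close>.\<close>
      let ?f = "\<lambda>y :: real. max 0 (1 - y * (1 + R))"
      have "(\<integral>x. ?f (r (\<kappa> n) x) \<partial>M) \<le> e" for n
      proof -
        have [measurable]: "\<kappa> n \<in> borel_measurable M" using meas \<kappa> by blast
        have "?f (r (\<kappa> n) x) \<le> indicator {x\<in>space M. \<kappa> n x > R} x" if "x \<in> space M" for x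
        proof (cases "\<kappa> n x > R")
          case True
          then show ?thesis using rk(1)[of n x] R0 that by simp
        next
          case False
          then have "1 \<le> (1 + R) / (1 + \<kappa> n x)" using pos[OF \<kappa>, of n x] by simp
          then show ?thesis by (simp add: r_def)
        qed
        then have "(\<integral>x. ?f (r (\<kappa> n) x) \<partial>M) \<le> (\<integral>x. indicator {x\<in>space M. \<kappa> n x > R} x \<partial>M)"
          by (intro integral_mono integrable_const_bound[of _ 1])
            (use rk R0 in \<open>auto intro!: mult_nonneg_nonneg less_imp_le\<close>)
        also have "\<dots> \<le> e" using R[OF \<kappa>] by simp
        finally show ?thesis .
      qed
      moreover have "(\<lambda>n. \<integral>x. ?f (r (\<kappa> n) x) \<partial>M) \<longlonglongrightarrow> (\<integral>x. ?f (g x) \<partial>M)"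
      proof (rule integral_dominated_convergence[of _ _ _ "\<lambda>_. 1"])
        show "AE x in M. (\<lambda>n. ?f (r (\<kappa> n) x)) \<longlonglongrightarrow> ?f (g x)"
          using lim by eventually_elim (intro tendsto_intros)
        show "AE x in M. norm (?f (r (\<kappa> n) x)) \<le> 1" for n
          using rk[of n] R0 by (auto intro!: mult_nonneg_nonneg less_imp_le)
      qed auto
      ultimately have "(\<integral>x. ?f (g x) \<partial>M) \<le> e" by (intro LIMSEQ_le_const2) auto
      moreover have "prob {x\<in>space M. g x \<le> 0} \<le> (\<integral>x. ?f (g x) \<partial>M)"
      proof -
        have "(\<integral>x. indicator {x\<in>space M. g x \<le> 0} x \<partial>M) \<le> (\<integral>x. ?f (g x) \<partial>M)"
        proof (rule integral_mono_AE)
          show "AE x in M. indicator {x\<in>space M. g x \<le> 0} x \<le> ?f (g x)"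
            using g_bd by eventually_elim (auto simp: indicator_def)
          show "integrable M (\<lambda>x. ?f (g x))"
            by (rule integrable_const_bound[of _ 1]) (use g_bd R0 in auto)
        qed (auto intro!: integrable_const_bound[of _ 1])
        then show ?thesis by simp
      qed
      ultimately show ?thesis by simp
    qed
    have "prob {x\<in>space M. g x \<le> 0} = 0"
      using le field_le_epsilon[of "prob {x\<in>space M. g x \<le> 0}" 0] measure_nonneg[of M "{x\<in>space M. g x \<le> 0}"]
      by (simp add: order_antisym)
    then have "AE x in M. \<not> g x \<le> 0"
      by (subst AE_iff_measurable[OF _ refl]) (auto simp: emeasure_eq_measure)
    then show ?thesis by (simp add: not_le)
  qed

  \<comment> \<open>Invariance of the limit\<close>
  have g_inv: "AE x in M. g (\<theta> x) = g x" if \<theta>: "\<theta> \<in> G" for \<theta>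
  proof -
    have [measurable]: "\<theta> \<in> measurable M M" and dist: "distr M M \<theta> = M" using G[OF \<theta>] by auto
    \<comment> \<open>Since \<open>\<theta>\<close> preserves the measure, the composed functions
      also form a minimising sequence in \<open>K\<close>, and \<open>L1\<close> compares it with
      the original one.\<close>
    have k\<theta>: "\<kappa> n \<circ> \<theta> \<in> K" for n using inv[OF \<theta> \<kappa>] .
    have r\<theta>: "r (\<kappa> n \<circ> \<theta>) x = r (\<kappa> n) (\<theta> x)" for n x by (simp add: r_def)
    have same: "(\<integral>x. r (\<kappa> n) (\<theta> x) \<partial>M) = (\<integral>x. r (\<kappa> n) x \<partial>M)" for n
      using integral_distr[of \<theta> M M "r (\<kappa> n)"] by (simp add: dist)
    have "AE x in distr M M \<theta>. (\<lambda>n. r (\<kappa> n) x) \<longlonglongrightarrow> g x" unfolding dist by (rule lim)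
    then have lim\<theta>: "AE x in M. (\<lambda>n. r (\<kappa> n) (\<theta> x)) \<longlonglongrightarrow> g (\<theta> x)"
      by (rule AE_distrD[rotated]) measurable
    have conv0: "(\<lambda>n. \<integral>x. \<bar>r (\<kappa> n) x - r (\<kappa> n) (\<theta> x)\<bar> \<partial>M) \<longlonglongrightarrow> (\<integral>x. \<bar>g x - g (\<theta> x)\<bar> \<partial>M)"
    proof (rule integral_dominated_convergence[of _ _ _ "\<lambda>_. 1"])
      show "AE x in M. (\<lambda>n. \<bar>r (\<kappa> n) x - r (\<kappa> n) (\<theta> x)\<bar>) \<longlonglongrightarrow> \<bar>g x - g (\<theta> x)\<bar>"
        using lim lim\<theta> by eventually_elim (intro tendsto_intros)
      have "\<bar>r (\<kappa> n) x - r (\<kappa> n) (\<theta> x)\<bar> \<le> 1" for n x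
        using rk[of n x] rk[of n "\<theta> x"] by linarith
      then show "AE x in M. norm \<bar>r (\<kappa> n) x - r (\<kappa> n) (\<theta> x)\<bar> \<le> 1" for n by simp
    qed auto
    have "(\<integral>x. \<bar>g x - g (\<theta> x)\<bar> \<partial>M) \<le> 0"
    proof (rule field_le_epsilon)
      fix e :: real assume e: "e > 0"
      \<comment> \<open>For fixed \<open>e\<close> both excesses tend to 0, which leaves
        \<open>e / 4\<close>.\<close>
      have "(\<lambda>n. e / 4 + 2 * ((\<integral>x. r (\<kappa> n) x \<partial>M) - I + ((\<integral>x. r (\<kappa> n) x \<partial>M) - I)) / e)
          \<longlonglongrightarrow> e / 4 + 2 * (I - I + (I - I)) / e"
        using e by (intro tendsto_intros \<kappa>I) auto
      then have "(\<integral>x. \<bar>g x - g (\<theta> x)\<bar> \<partial>M) \<le> e / 4 + 2 * (I - I + (I - I)) / e"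
        by (rule LIMSEQ_le[OF conv0]) (use L1[OF \<kappa> k\<theta> e] in \<open>simp only: r\<theta> same, blast\<close>)
      then show "(\<integral>x. \<bar>g x - g (\<theta> x)\<bar> \<partial>M) \<le> 0 + e" using e by simp
    qed
    moreover have "AE x in M. \<bar>g x - g (\<theta> x)\<bar> \<le> 1"
    proof -
      have "AE x in distr M M \<theta>. 0 \<le> g x \<and> g x \<le> 1" unfolding dist by (rule g_bd)
      then have "AE x in M. 0 \<le> g (\<theta> x) \<and> g (\<theta> x) \<le> 1" by (rule AE_distrD[rotated]) measurable
      with g_bd show ?thesis by eventually_elim linarith
    qed
    then have int: "integrable M (\<lambda>x. \<bar>g x - g (\<theta> x)\<bar>)"
      by (intro integrable_const_bound[of _ 1]) auto
    moreover have "(\<integral>x. \<bar>g x - g (\<theta> x)\<bar> \<partial>M) \<ge> 0" by simp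
    ultimately have "(\<integral>x. \<bar>g x - g (\<theta> x)\<bar> \<partial>M) = 0" by linarith
    then have "AE x in M. \<bar>g x - g (\<theta> x)\<bar> = 0"
      using integral_nonneg_eq_0_iff_AE[OF int] by simp
    then show ?thesis by eventually_elim simp
  qed

  \<comment> \<open>First variation at the minimum\<close>
  have g_K: "integrable M (\<lambda>x. (g x)\<^sup>2 * k x) \<and> (\<integral>x. (g x)\<^sup>2 * k x \<partial>M) \<le> 1" if k: "k \<in> K" for k
  proof -
    have [measurable]: "k \<in> borel_measurable M" using meas[OF k] .
    have k0: "k x \<ge> 0" for x using pos[OF k] .
    \<comment> \<open>Dividing by \<open>1 + \<kappa> n x\<close> expresses \<open>r\<close> of the
      combination \<open>(1 - t) * \<kappa> n + t * k\<close> through \<open>r (\<kappa> n)\<close>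
      and \<open>k\<close> alone, as \<open>?h\<close> below. Its limit is
      \<open>g x / D t x\<close>, so convergence of \<open>\<kappa> n\<close> itself never
      enters.\<close>
    define D where "D t x = 1 - t + t * ((1 + k x) * g x)" for t x
    have [measurable]: "D t \<in> borel_measurable M" for t unfolding D_def by measurable
    have var: "(\<integral>x. (g x)\<^sup>2 * (1 + k x) / D t x \<partial>M) \<le> 1 / (1 - t)
        \<and> integrable M (\<lambda>x. (g x)\<^sup>2 * (1 + k x) / D t x)" if t: "0 < t" "t < 1" for t
    proof -
      let ?h = "\<lambda>y x. y / (1 - t + t * ((1 + k x) * y))"
      have den: "1 - t + t * ((1 + k x) * y) \<ge> 1 - t" if "y \<ge> 0" for x y
        using t that k0[of x] by simp
      have hbd: "\<bar>?h y x\<bar> \<le> 1 / (1 - t)" if "0 \<le> y" "y \<le> 1" for x y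
        unfolding abs_divide using den[OF that(1), of x] t that by (intro frac_le) auto
      have conv_h: "(\<lambda>n. \<integral>x. ?h (r (\<kappa> n) x) x \<partial>M) \<longlonglongrightarrow> (\<integral>x. ?h (g x) x \<partial>M)"
      proof (rule integral_dominated_convergence[of _ _ _ "\<lambda>_. 1 / (1 - t)"])
        show "AE x in M. (\<lambda>n. ?h (r (\<kappa> n) x) x) \<longlonglongrightarrow> ?h (g x) x"
          using lim g_bd
        proof eventually_elim
          case (elim x)
          then show ?case using den[of "g x" x] t by (intro tendsto_intros) auto
        qed
        show "AE x in M. norm (?h (r (\<kappa> n) x) x) \<le> 1 / (1 - t)" for n
          using hbd rk[of n] by (auto simp: less_imp_le)
      qed auto
      have "I \<le> (\<integral>x. ?h (r (\<kappa> n) x) x \<partial>M)" for n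
      proof -
        have "r (\<lambda>x. (1 - t) * \<kappa> n x + t * k x) x = ?h (r (\<kappa> n) x) x" for x
        proof -
          have a: "1 + \<kappa> n x > 0" using pos[OF \<kappa>, of n x] by simp
          have "?h (r (\<kappa> n) x) x = 1 / ((1 - t) * (1 + \<kappa> n x) + t * (1 + k x))"
            using a by (simp add: r_def field_simps)
          also have "\<dots> = r (\<lambda>x. (1 - t) * \<kappa> n x + t * k x) x"
            by (simp add: r_def algebra_simps)
          finally show ?thesis by simp
        qed
        then show ?thesis using I_le[OF conv[OF \<kappa>[of n] k t]] by simp
      qed
      then have Ig: "(\<integral>x. g x \<partial>M) \<le> (\<integral>x. ?h (g x) x \<partial>M)"
        unfolding gI by (intro LIMSEQ_le_const[OF conv_h]) auto
      have h_int: "integrable M (\<lambda>x. ?h (g x) x)"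
        by (rule integrable_const_bound[of _ "1 / (1 - t)"]) (use g_bd hbd in auto)
      \<comment> \<open>This isolates the difference quotient of the functional in the direction of
        \<open>k\<close>. By \<open>Ig\<close> its integral is non-negative, so the left side has
        integral at most that of \<open>?h (g x) x\<close>, hence at most
        \<open>1 / (1 - t)\<close>.\<close>
      have id: "AE x in M. (g x)\<^sup>2 * (1 + k x) / D t x = ?h (g x) x - (?h (g x) x - g x) / t"
        using g_bd
      proof eventually_elim
        case (elim x)
        then have "D t x > 0" using den[of "g x" x] t by (simp add: D_def)
        moreover have "g x / D t x - (g x / D t x - g x) / t = g x * (t - 1 + D t x) / (t * D t x)"
          using t calculation(1) by (simp add: field_simps)
        moreover have "t - 1 + D t x = t * ((1 + k x) * g x)" by (simp add: D_def)
        ultimately have "(g x)\<^sup>2 * (1 + k x) / D t x = g x / D t x - (g x / D t x - g x) / t"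
          using t by (simp add: power2_eq_square ac_simps)
        then show ?case by (simp only: D_def)
      qed
      have int': "integrable M (\<lambda>x. ?h (g x) x - (?h (g x) x - g x) / t)"
        using h_int g_int by auto
      have i1: "integrable M (\<lambda>x. (g x)\<^sup>2 * (1 + k x) / D t x)"
        by (rule iffD2[OF integrable_cong_AE int']) (use id in auto)
      have "(\<integral>x. (g x)\<^sup>2 * (1 + k x) / D t x \<partial>M) = (\<integral>x. ?h (g x) x - (?h (g x) x - g x) / t \<partial>M)"
        by (rule integral_cong_AE) (use id in auto)
      also have "\<dots> = (\<integral>x. ?h (g x) x \<partial>M) - ((\<integral>x. ?h (g x) x \<partial>M) - (\<integral>x. g x \<partial>M)) / t"
        using h_int g_int by simp
      also have "\<dots> \<le> (\<integral>x. ?h (g x) x \<partial>M)" using Ig t by simp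
      also have "\<dots> \<le> (\<integral>x. 1 / (1 - t) \<partial>M)"
      proof (rule integral_mono_AE[OF h_int])
        show "AE x in M. ?h (g x) x \<le> 1 / (1 - t)"
          using g_bd by eventually_elim (use hbd abs_le_D1 in blast)
      qed simp
      also have "\<dots> = 1 / (1 - t)" by (simp add: prob_space)
      finally show ?thesis using i1 by blast
    qed
    \<comment> \<open>The shift by 2 keeps \<open>t n\<close> strictly below 1 for every
      \<open>n\<close>.\<close>
    define t where "t n = 1 / real (n + 2)" for n
    have t: "0 < t n" "t n < 1" for n by (auto simp: t_def)
    have t0: "t \<longlonglongrightarrow> 0"
      unfolding t_def using LIMSEQ_ignore_initial_segment[OF lim_1_over_n, of 2] by simp
    have D_pos: "AE x in M. \<forall>n. D (t n) x > 0"
      using g_bd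
    proof eventually_elim
      case (elim x)
      have "0 \<le> t n * ((1 + k x) * g x)" for n
        using t[of n] k0[of x] elim by simp
      then show ?case using t by (simp add: D_def add_pos_nonneg)
    qed
    let ?F = "\<lambda>n x. ennreal ((g x)\<^sup>2 * (1 + k x) / D (t n) x)"
    have F: "(\<integral>\<^sup>+x. ?F n x \<partial>M) \<le> ennreal (1 / (1 - t n))" for n
    proof -
      have "AE x in M. 0 \<le> (g x)\<^sup>2 * (1 + k x) / D (t n) x"
        using D_pos by eventually_elim (use k0 in \<open>auto intro!: divide_nonneg_pos mult_nonneg_nonneg add_nonneg_nonneg\<close>)
      then show ?thesis
        using nn_integral_eq_integral[of M "\<lambda>x. (g x)\<^sup>2 * (1 + k x) / D (t n) x"] var[OF t, of n]
        by (simp add: ennreal_leI)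
    qed
    \<comment> \<open>Fatou's lemma: \<open>D (t n) x\<close> tends to 1 at every \<open>x\<close>,
      and the bounds \<open>1 / (1 - t n)\<close> tend to 1.\<close>
    have "(\<integral>\<^sup>+x. ennreal ((g x)\<^sup>2 * (1 + k x)) \<partial>M) = (\<integral>\<^sup>+x. liminf (\<lambda>n. ?F n x) \<partial>M)"
    proof (rule nn_integral_cong_AE)
      show "AE x in M. ennreal ((g x)\<^sup>2 * (1 + k x)) = liminf (\<lambda>n. ?F n x)"
      proof (rule AE_I2)
        fix x
        have "(\<lambda>n. D (t n) x) \<longlonglongrightarrow> 1 - 0 + 0 * ((1 + k x) * g x)"
          unfolding D_def by (intro tendsto_intros t0)
        then have "(\<lambda>n. ?F n x) \<longlonglongrightarrow> ennreal ((g x)\<^sup>2 * (1 + k x) / 1)"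
          by (intro tendsto_ennrealI tendsto_divide tendsto_const) auto
        then show "ennreal ((g x)\<^sup>2 * (1 + k x)) = liminf (\<lambda>n. ?F n x)"
          using lim_imp_Liminf[OF sequentially_bot] by fastforce
      qed
    qed
    also have "\<dots> \<le> liminf (\<lambda>n. \<integral>\<^sup>+x. ?F n x \<partial>M)"
      by (rule nn_integral_liminf) measurable
    also have "\<dots> \<le> liminf (\<lambda>n. ennreal (1 / (1 - t n)))"
      by (rule Liminf_mono) (use F in auto)
    also have "\<dots> = ennreal (1 / (1 - 0))"
      by (rule lim_imp_Liminf) (simp, intro tendsto_ennrealI tendsto_intros t0, simp)
    finally have fin: "(\<integral>\<^sup>+x. ennreal ((g x)\<^sup>2 * (1 + k x)) \<partial>M) \<le> 1" by simp
    have "(\<integral>\<^sup>+x. ennreal ((g x)\<^sup>2 * k x) \<partial>M) \<le> (\<integral>\<^sup>+x. ennreal ((g x)\<^sup>2 * (1 + k x)) \<partial>M)"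
      by (intro nn_integral_mono ennreal_leI mult_left_mono) auto
    then have fin': "(\<integral>\<^sup>+x. ennreal ((g x)\<^sup>2 * k x) \<partial>M) \<le> 1" using fin by (rule order_trans)
    then have "integrable M (\<lambda>x. (g x)\<^sup>2 * k x)"
      by (intro integrableI_nonneg) (use k0 in \<open>auto simp: le_less_trans\<close>)
    moreover have "(\<integral>x. (g x)\<^sup>2 * k x \<partial>M) \<le> 1"
      using fin' k0 by (intro integral_real_bounded) auto
    ultimately show ?thesis ..
  qed
  show ?thesis using g_meas g_pos g_inv g_K by blast
qed

section \<open>Sums of squares of a linear map into measurable functions\<close>

text \<open>The expectation of \<open>F\<close> at \<open>v\<close> plus the sum of the list with
  independent fair signs. The accumulator \<open>v\<close> allows structural induction without a
  probability space of signs.\<close>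

fun sign_average :: "('v::ab_group_add \<Rightarrow> real) \<Rightarrow> 'v list \<Rightarrow> 'v \<Rightarrow> real" where
  "sign_average F [] v = F v"
| "sign_average F (x # xs) v = (sign_average F xs (v + x) + sign_average F xs (v - x)) / 2"

lemma sign_average_mono: "(\<And>v. F v \<le> G v) \<Longrightarrow> sign_average F xs v \<le> sign_average G xs v"
proof (induction xs arbitrary: v)
  case (Cons x xs)
  from Cons.IH[OF Cons.prems, of "v + x"] Cons.IH[OF Cons.prems, of "v - x"] show ?case by simp
qed simp

lemma sign_average_lincomb:
  "sign_average (\<lambda>v. a * F v + b * G v + c) xs v = a * sign_average F xs v + b * sign_average G xs v + c"
  by (induction xs arbitrary: v) (simp_all add: field_simps)

text \<open>Cross terms cancel between the two signs of each entry; the induction step is the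
  parallelogram law.\<close>

lemma sign_average_norm_sq:
  "sign_average (\<lambda>v. (norm v)\<^sup>2) xs v = (norm (v :: 'a::chilbert_space))\<^sup>2 + (\<Sum>x\<leftarrow>xs. (norm x)\<^sup>2)"
proof (induction xs arbitrary: v)
  case (Cons x xs)
  then show ?case using parallelogram_chilbert[of v x] by simp
qed simp

lemma sign_average_square: "sign_average (\<lambda>z. z\<^sup>2) xs v = (v :: real)\<^sup>2 + (\<Sum>x\<leftarrow>xs. x\<^sup>2)"
  by (induction xs arbitrary: v) (simp_all add: power2_sum power2_diff)

text \<open>Khintchine's inequality for the fourth moment, with the Gaussian constant 3 at
  \<open>v = 0\<close>. The terms in \<open>v\<close> make the induction go through; each step
  discards \<open>2 * x ^ 4\<close>.\<close>

lemma sign_average_fourth: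
  "sign_average (\<lambda>z. z ^ 4) xs v \<le> (v :: real) ^ 4 + 6 * v\<^sup>2 * (\<Sum>x\<leftarrow>xs. x\<^sup>2) + 3 * (\<Sum>x\<leftarrow>xs. x\<^sup>2)\<^sup>2"
proof (induction xs arbitrary: v)
  case (Cons x xs)
  let ?A = "\<Sum>x\<leftarrow>xs. x\<^sup>2"
  have "sign_average (\<lambda>z. z ^ 4) (x # xs) v \<le>
      ((v + x) ^ 4 + (v - x) ^ 4) / 2 + 6 * (((v + x)\<^sup>2 + (v - x)\<^sup>2) / 2) * ?A + 3 * ?A\<^sup>2"
    using Cons.IH[of "v + x"] Cons.IH[of "v - x"] by (simp add: algebra_simps add_divide_distrib)
  also have "\<dots> = v ^ 4 + 6 * v\<^sup>2 * (x\<^sup>2 + ?A) + 3 * (x\<^sup>2 + ?A)\<^sup>2 - 2 * x ^ 4"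
    by (simp add: power2_eq_square power4_eq_xxxx algebra_simps add_divide_distrib diff_divide_distrib)
  also have "\<dots> \<le> v ^ 4 + 6 * v\<^sup>2 * (x\<^sup>2 + ?A) + 3 * (x\<^sup>2 + ?A)\<^sup>2" by simp
  finally show ?case by simp
qed simp

text \<open>A Paley--Zygmund inequality: \<open>q\<close> below is at most the indicator of \<open>z\<^sup>2 > r\<close>, and its sign
  average is controlled by the second and fourth moments.\<close>

lemma sign_average_large:
  assumes "r \<ge> 0" and large: "(\<Sum>x\<leftarrow>xs. x\<^sup>2) > 4 * r"
  shows "1 / 16 \<le> sign_average (\<lambda>z :: real. if z\<^sup>2 > r then 1 else 0) xs 0"
proof -
  define A where "A = (\<Sum>x\<leftarrow>xs. x\<^sup>2)"
  have A: "A > 4 * r" "A > 0" using assms by (auto simp: A_def)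
  \<comment> \<open>In the variable \<open>z\<^sup>2\<close> this is the concave parabola with zeros
    \<open>A / 4\<close> and \<open>4 * A\<close>, scaled to have maximum 1, attained at
    \<open>17 / 8 * A\<close>. Since \<open>r < A / 4\<close>, it is non-positive wherever
    \<open>z\<^sup>2 \<le> r\<close>. The moments give an average of at least (272 - 192 - 64) / 225
    = 16 / 225, which exceeds 1 / 16.\<close>
  define q where "q z = (- 64 / (225 * A\<^sup>2)) * z ^ 4 + (272 / (225 * A)) * z\<^sup>2 + - 64 / 225" for z :: real
  have q_eq: "q z = 64 / (225 * A\<^sup>2) * ((z\<^sup>2 - A / 4) * (4 * A - z\<^sup>2))" for z
    using A by (simp add: q_def field_simps power2_eq_square power4_eq_xxxx)
  have "q z \<le> (if z\<^sup>2 > r then 1 else 0)" for z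
  proof (cases "z\<^sup>2 > r")
    case True
    have "1 - q z = 64 / (225 * A\<^sup>2) * (z\<^sup>2 - 17 / 8 * A)\<^sup>2"
      unfolding q_eq using A by (simp add: field_simps power2_eq_square)
    then have "1 - q z \<ge> 0" by simp
    then show ?thesis using True by simp
  next
    case False
    then have "(z\<^sup>2 - A / 4) * (4 * A - z\<^sup>2) \<le> 0"
      using A by (intro mult_nonpos_nonneg) auto
    then show ?thesis
      using False A unfolding q_eq by (simp add: mult_nonneg_nonpos divide_nonpos_nonneg)
  qed
  then have "sign_average q xs 0 \<le> sign_average (\<lambda>z. if z\<^sup>2 > r then 1 else 0) xs 0"
    by (rule sign_average_mono)
  moreover have "sign_average q xs 0 \<ge> 1 / 16"
  proof -
    have "64 / (225 * A\<^sup>2) * sign_average (\<lambda>z. z ^ 4) xs 0 \<le> 64 / (225 * A\<^sup>2) * (3 * A\<^sup>2)"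
      using sign_average_fourth[of xs 0] by (intro mult_left_mono) (auto simp: A_def)
    also have "\<dots> = 192 / 225" using A by simp
    finally have "(- 64 / (225 * A\<^sup>2)) * sign_average (\<lambda>z. z ^ 4) xs 0 \<ge> - 192 / 225" by simp
    moreover have "sign_average (\<lambda>z. z\<^sup>2) xs 0 = A" by (simp add: sign_average_square A_def)
    then have "(272 / (225 * A)) * sign_average (\<lambda>z. z\<^sup>2) xs 0 = 272 / 225" using A by simp
    ultimately show ?thesis unfolding q_def sign_average_lincomb by simp
  qed
  ultimately show ?thesis by simp
qed

lemma sign_average_integral:
  assumes "\<And>v. integrable M (\<lambda>x. F v x)"
  shows "integrable M (\<lambda>x. sign_average (\<lambda>v. F v x) vs v)"
    and "(\<integral>x. sign_average (\<lambda>v. F v x) vs v \<partial>M) = sign_average (\<lambda>v. \<integral>x. F v x \<partial>M) vs v"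
proof -
  have "integrable M (\<lambda>x. sign_average (\<lambda>v. F v x) vs v)
      \<and> (\<integral>x. sign_average (\<lambda>v. F v x) vs v \<partial>M) = sign_average (\<lambda>v. \<integral>x. F v x \<partial>M) vs v"
    using assms by (induction vs arbitrary: v) auto
  then show "integrable M (\<lambda>x. sign_average (\<lambda>v. F v x) vs v)"
    and "(\<integral>x. sign_average (\<lambda>v. F v x) vs v \<partial>M) = sign_average (\<lambda>v. \<integral>x. F v x \<partial>M) vs v"
    by auto
qed

section \<open>Square sums in the range of a linear map, and their weight\<close>

context prob_space
begin

text \<open>Additivity is used for finitely many pairs of vectors only, so the exceptional sets
  together remain null.\<close>

lemma sign_average_linear_AE:
  fixes T :: "'h::real_vector \<Rightarrow> 'a \<Rightarrow> real"
  assumes add: "\<And>\<xi> \<eta>. AE x in M. T (\<xi> + \<eta>) x = T \<xi> x + T \<eta> x"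
    and scale: "\<And>c \<xi>. AE x in M. T (c *\<^sub>R \<xi>) x = c * T \<xi> x"
  shows "AE x in M. sign_average (\<lambda>v. F (T v x)) \<xi>s \<eta> = sign_average F (map (\<lambda>\<xi>. T \<xi> x) \<xi>s) (T \<eta> x)"
proof (induction \<xi>s arbitrary: \<eta>)
  case (Cons \<xi> \<xi>s)
  show ?case
    using Cons.IH[of "\<eta> + \<xi>"] Cons.IH[of "\<eta> - \<xi>"] add[of \<eta> \<xi>] add[of \<eta> "-1 *\<^sub>R \<xi>"] scale[of "-1" \<xi>]
    by eventually_elim simp
qed simp

text \<open>Where the square sum exceeds \<open>4 * r\<close>, at least 1 / 16 of the signed sums
  have an image with square above \<open>r\<close>. For a single vector the probability of that is
  at most \<open>e / 32 * (1 + (norm \<xi>)\<^sup>2)\<close>, and the squared norm of a signed sum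
  averages to at most 1, which gives \<open>e / 16\<close> in total.\<close>

lemma square_sums_bounded_in_measure:
  fixes T :: "'h::chilbert_space \<Rightarrow> 'a \<Rightarrow> real"
  assumes T_meas [measurable]: "\<And>\<xi>. T \<xi> \<in> borel_measurable M"
    and add: "\<And>\<xi> \<eta>. AE x in M. T (\<xi> + \<eta>) x = T \<xi> x + T \<eta> x"
    and scale: "\<And>c \<xi>. AE x in M. T (c *\<^sub>R \<xi>) x = c * T \<xi> x"
    and tight: "\<And>e. e > 0 \<Longrightarrow> \<exists>\<delta>>0. \<forall>\<xi>. norm \<xi> \<le> \<delta> \<longrightarrow> prob {x\<in>space M. \<bar>T \<xi> x\<bar> > 2} \<le> e"
    and e: "e > 0"
  shows "\<exists>R. \<forall>\<xi>s. (\<Sum>\<xi>\<leftarrow>\<xi>s. (norm \<xi>)\<^sup>2) \<le> 1 \<longrightarrow> prob {x\<in>space M. (\<Sum>\<xi>\<leftarrow>\<xi>s. (T \<xi> x)\<^sup>2) > R} \<le> e"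
proof -
  obtain \<delta> where \<delta>: "\<delta> > 0" "\<And>\<xi>. norm \<xi> \<le> \<delta> \<Longrightarrow> prob {x\<in>space M. \<bar>T \<xi> x\<bar> > 2} \<le> e / 32"
    using tight[of "e / 32"] e by auto
  \<comment> \<open>Beyond norm \<open>N\<close> the trivial bound 1 is already at most
    \<open>e / 32 * (norm \<xi>)\<^sup>2\<close>. Up to norm \<open>N\<close>, scaling by
    \<open>\<delta> / N\<close> leads into the ball of radius \<open>\<delta>\<close> and turns the
    threshold 2 into \<open>2 * N / \<delta>\<close>, the root of \<open>r\<close>.\<close>
  define N where "N = sqrt (32 / e)"
  have N: "N > 0" "N\<^sup>2 = 32 / e" using e by (auto simp: N_def)
  define r where "r = (2 * N / \<delta>)\<^sup>2"
  define F where "F = (\<lambda>z :: real. if z\<^sup>2 > r then 1 else 0 :: real)"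
  have F_int: "integrable M (\<lambda>x. F (T \<xi> x))" for \<xi>
    unfolding F_def by (rule integrable_const_bound[of _ 1]) auto
  (* the summand 0 * 0 gives the bound the shape of sign_average_lincomb *)
  have F_le: "(\<integral>x. F (T \<xi> x) \<partial>M) \<le> e / 32 * (norm \<xi>)\<^sup>2 + 0 * 0 + e / 32" for \<xi>
  proof (cases "norm \<xi> \<le> N")
    case True
    have "AE x in M. F (T \<xi> x) = indicator {x\<in>space M. \<bar>T ((\<delta> / N) *\<^sub>R \<xi>) x\<bar> > 2} x"
      using scale[of "\<delta> / N" \<xi>] AE_space
    proof eventually_elim
      case (elim x)
      have "(T \<xi> x)\<^sup>2 > r \<longleftrightarrow> \<bar>T \<xi> x\<bar> > \<bar>2 * N / \<delta>\<bar>"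
        unfolding r_def using abs_le_square_iff[of "T \<xi> x" "2 * N / \<delta>"] by (simp add: not_le[symmetric])
      also have "\<dots> \<longleftrightarrow> \<bar>\<delta> / N * T \<xi> x\<bar> > 2"
        using N(1) \<delta>(1) by (simp add: abs_mult field_simps)
      finally show ?case using elim by (simp add: F_def)
    qed
    then have "(\<integral>x. F (T \<xi> x) \<partial>M) = (\<integral>x. indicator {x\<in>space M. \<bar>T ((\<delta> / N) *\<^sub>R \<xi>) x\<bar> > 2} x \<partial>M)"
      by (intro integral_cong_AE) (auto simp: F_def)
    also have "\<dots> = prob {x\<in>space M. \<bar>T ((\<delta> / N) *\<^sub>R \<xi>) x\<bar> > 2}" by simp
    also have "\<dots> \<le> e / 32"
      using True N(1) \<delta>(1) by (intro \<delta>(2)) (simp add: field_simps)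
    finally show ?thesis using e by (simp add: add_increasing)
  next
    case False
    have "(\<integral>x. F (T \<xi> x) \<partial>M) \<le> (\<integral>x. 1 \<partial>M)"
      by (rule integral_mono[OF F_int]) (auto simp: F_def)
    also have "\<dots> = e / 32 * N\<^sup>2" using e by (simp add: prob_space N(2))
    also have "\<dots> \<le> e / 32 * (norm \<xi>)\<^sup>2"
      using False N(1) e by (intro mult_left_mono power_mono) auto
    finally show ?thesis using e by simp
  qed
  have zero: "AE x in M. T 0 x = 0" using scale[of 0 0] by simp
  have "prob {x\<in>space M. (\<Sum>\<xi>\<leftarrow>\<xi>s. (T \<xi> x)\<^sup>2) > 4 * r} \<le> e"
    if le1: "(\<Sum>\<xi>\<leftarrow>\<xi>s. (norm \<xi>)\<^sup>2) \<le> 1" for \<xi>s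
  proof -
    define k where "k x = (\<Sum>\<xi>\<leftarrow>\<xi>s. (T \<xi> x)\<^sup>2)" for x
    have k_meas [measurable]: "k \<in> borel_measurable M"
      unfolding k_def by (induction \<xi>s) auto
    let ?E = "{x\<in>space M. k x > 4 * r}"
    have "1 / 16 * prob ?E = (\<integral>x. 1 / 16 * indicator ?E x \<partial>M)" by simp
    also have "\<dots> \<le> (\<integral>x. sign_average (\<lambda>\<eta>. F (T \<eta> x)) \<xi>s 0 \<partial>M)"
    proof (rule integral_mono_AE)
      show "AE x in M. 1 / 16 * indicator ?E x \<le> sign_average (\<lambda>\<eta>. F (T \<eta> x)) \<xi>s 0"
        using sign_average_linear_AE[OF add scale, of F \<xi>s 0] zero
      proof eventually_elim
        case (elim x)
        let ?as = "map (\<lambda>\<xi>. T \<xi> x) \<xi>s"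
        have kx: "k x = (\<Sum>a\<leftarrow>?as. a\<^sup>2)" by (simp add: k_def comp_def)
        have "0 \<le> sign_average F ?as 0"
          using sign_average_mono[of "\<lambda>_. 0" F ?as 0] sign_average_lincomb[of 0 F 0 F 0 ?as 0]
          by (simp add: F_def)
        moreover have "1 / 16 \<le> sign_average F ?as 0" if "k x > 4 * r"
          unfolding F_def by (rule sign_average_large) (use that kx r_def in auto)
        ultimately show ?case using elim by (auto simp: indicator_def)
      qed
    qed (auto intro: sign_average_integral(1)[OF F_int] integrable_const_bound[of _ "1 / 16"])
    also have "\<dots> = sign_average (\<lambda>\<eta>. \<integral>x. F (T \<eta> x) \<partial>M) \<xi>s 0"
      by (rule sign_average_integral(2)[OF F_int])
    also have "\<dots> \<le> sign_average (\<lambda>\<eta>. e / 32 * (norm \<eta>)\<^sup>2 + 0 * 0 + e / 32) \<xi>s 0"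
      by (rule sign_average_mono) (rule F_le)
    also have "\<dots> = e / 32 * (\<Sum>\<xi>\<leftarrow>\<xi>s. (norm \<xi>)\<^sup>2) + e / 32"
      unfolding sign_average_lincomb sign_average_norm_sq by simp
    also have "\<dots> \<le> e / 32 * 1 + e / 32"
      using le1 e by (intro add_right_mono mult_left_mono) auto
    finally show ?thesis by (simp add: k_def)
  qed
  then show ?thesis by blast
qed

text \<open>Single squares do not form a convex set, finite sums of squares do; lists of vectors
  represent these sums, and \<open>Q\<close> is the cost of a list. As \<open>q\<close> dominates
  the squared norm, lists of cost at most 1 give sums bounded in measure.\<close>

lemma equivariant_factorization:
  fixes T :: "'h::chilbert_space \<Rightarrow> 'a \<Rightarrow> real" and q :: "'h \<Rightarrow> real"
    and J :: "'i set" and \<theta> :: "'i \<Rightarrow> 'a \<Rightarrow> 'a" and p :: "'i \<Rightarrow> 'h \<Rightarrow> 'h"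
  assumes T_meas [measurable]: "\<And>\<xi>. T \<xi> \<in> borel_measurable M"
    and add: "\<And>\<xi> \<eta>. AE x in M. T (\<xi> + \<eta>) x = T \<xi> x + T \<eta> x"
    and scale: "\<And>c \<xi>. AE x in M. T (c *\<^sub>R \<xi>) x = c * T \<xi> x"
    and tight: "\<And>e. e > 0 \<Longrightarrow> \<exists>\<delta>>0. \<forall>\<xi>. norm \<xi> \<le> \<delta> \<longrightarrow> prob {x\<in>space M. \<bar>T \<xi> x\<bar> > 2} \<le> e"
    and \<theta>: "\<And>i. i \<in> J \<Longrightarrow> \<theta> i \<in> measurable M M \<and> distr M M (\<theta> i) = M"
    and equi: "\<And>i \<xi>. i \<in> J \<Longrightarrow> AE x in M. T \<xi> (\<theta> i x) = T (p i \<xi>) x"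
    and q_scale: "\<And>c \<xi>. q (c *\<^sub>R \<xi>) \<le> c\<^sup>2 * q \<xi>"
    and q_norm: "\<And>\<xi>. (norm \<xi>)\<^sup>2 \<le> q \<xi>"
    and q_inv: "\<And>i \<xi>. i \<in> J \<Longrightarrow> q (p i \<xi>) \<le> q \<xi>"
  shows "\<exists>g. g \<in> borel_measurable M \<and> (AE x in M. 0 < g x) \<and>
     (\<forall>i\<in>J. AE x in M. g (\<theta> i x) = g x) \<and>
     (\<forall>\<xi>. q \<xi> \<le> 1 \<longrightarrow> integrable M (\<lambda>x. (g x)\<^sup>2 * (T \<xi> x)\<^sup>2) \<and> (\<integral>x. (g x)\<^sup>2 * (T \<xi> x)\<^sup>2 \<partial>M) \<le> 1)"
proof -
  define \<Sigma> where "\<Sigma> \<xi>s x = (\<Sum>\<xi>\<leftarrow>\<xi>s. (T \<xi> x)\<^sup>2)" for \<xi>s x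
  have \<Sigma>_meas [measurable]: "\<Sigma> \<xi>s \<in> borel_measurable M" for \<xi>s
    unfolding \<Sigma>_def by (induction \<xi>s) auto
  define Q where "Q \<xi>s = (\<Sum>\<xi>\<leftarrow>\<xi>s. q \<xi>)" for \<xi>s
  \<comment> \<open>The representation by a list holds up to null sets, since equivariance does.
    Sign and measurability are demanded of the function itself, as \<open>invariant_weight\<close>
    asks for them at every point.\<close>
  define K where "K = {k \<in> borel_measurable M. (\<forall>x. 0 \<le> k x) \<and> (\<exists>\<xi>s. Q \<xi>s \<le> 1 \<and> (AE x in M. k x = \<Sigma> \<xi>s x))}"
  have K_meas [measurable]: "k \<in> borel_measurable M" and K_nonneg: "0 \<le> k x"
    and K_sum: "\<exists>\<xi>s. Q \<xi>s \<le> 1 \<and> (AE x in M. k x = \<Sigma> \<xi>s x)" if "k \<in> K" for k x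
    using that unfolding K_def by blast+
  have KI: "k \<in> K" if "k \<in> borel_measurable M" "\<And>x. 0 \<le> k x" "Q \<xi>s \<le> 1" "AE x in M. k x = \<Sigma> \<xi>s x" for k \<xi>s
    using that unfolding K_def by blast
  have Q_scale: "Q (map ((*\<^sub>R) c) \<xi>s) \<le> c\<^sup>2 * Q \<xi>s" for c \<xi>s
    unfolding Q_def by (induction \<xi>s) (use q_scale in \<open>auto simp: distrib_left intro!: add_mono\<close>)
  have \<Sigma>_scale: "AE x in M. \<Sigma> (map ((*\<^sub>R) c) \<xi>s) x = c\<^sup>2 * \<Sigma> \<xi>s x" for c \<xi>s
  proof (induction \<xi>s)
    case (Cons \<xi> \<xi>s)
    then show ?case using scale[of c \<xi>]
      by eventually_elim (simp add: \<Sigma>_def power_mult_distrib algebra_simps)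
  qed (simp add: \<Sigma>_def)
  have Q_norm: "(\<Sum>\<xi>\<leftarrow>\<xi>s. (norm \<xi>)\<^sup>2) \<le> Q \<xi>s" for \<xi>s
    unfolding Q_def by (rule sum_list_mono) (rule q_norm)
  have Q_inv: "Q (map (p i) \<xi>s) \<le> Q \<xi>s" if "i \<in> J" for i \<xi>s
    unfolding Q_def using q_inv[OF that] by (auto simp: comp_def intro!: sum_list_mono)
  have \<Sigma>_inv: "AE x in M. \<Sigma> \<xi>s (\<theta> i x) = \<Sigma> (map (p i) \<xi>s) x" if "i \<in> J" for i \<xi>s
  proof (induction \<xi>s)
    case (Cons \<xi> \<xi>s)
    then show ?case using equi[OF that, of \<xi>] by eventually_elim (simp add: \<Sigma>_def)
  qed (simp add: \<Sigma>_def)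
  have "\<exists>g. g \<in> borel_measurable M \<and> (AE x in M. 0 < g x) \<and>
     (\<forall>\<phi>\<in>\<theta> ` J. AE x in M. g (\<phi> x) = g x) \<and>
     (\<forall>k\<in>K. integrable M (\<lambda>x. (g x)\<^sup>2 * k x) \<and> (\<integral>x. (g x)\<^sup>2 * k x \<partial>M) \<le> 1)"
  proof (rule invariant_weight)
    have "\<Sigma> [] \<in> K" by (intro KI[of _ "[]"]) (auto simp: \<Sigma>_def Q_def)
    then show "K \<noteq> {}" by blast
    show "(\<lambda>x. (1 - t) * k x + t * k' x) \<in> K" if k: "k \<in> K" "k' \<in> K" and t: "0 < t" "t < 1" for k k' t
    proof -
      obtain \<xi>s where \<xi>s: "Q \<xi>s \<le> 1" "AE x in M. k x = \<Sigma> \<xi>s x" using K_sum[OF k(1)] by blast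
      obtain \<eta>s where \<eta>s: "Q \<eta>s \<le> 1" "AE x in M. k' x = \<Sigma> \<eta>s x" using K_sum[OF k(2)] by blast
      \<comment> \<open>Scaling vectors by a square root scales the squares, and at most scales the
        cost, by the weight; concatenation then realises the convex combination.\<close>
      let ?us = "map ((*\<^sub>R) (sqrt (1 - t))) \<xi>s" and ?vs = "map ((*\<^sub>R) (sqrt t)) \<eta>s"
      have "Q (?us @ ?vs) = Q ?us + Q ?vs" by (simp add: Q_def)
      also have "\<dots> \<le> (1 - t) * Q \<xi>s + t * Q \<eta>s"
        using t Q_scale[of "sqrt (1 - t)" \<xi>s] Q_scale[of "sqrt t" \<eta>s] by simp
      also have "\<dots> \<le> (1 - t) * 1 + t * 1"
        using \<xi>s(1) \<eta>s(1) t by (intro add_mono mult_left_mono) auto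
      finally have "Q (?us @ ?vs) \<le> 1" by simp
      moreover have "AE x in M. (1 - t) * k x + t * k' x = \<Sigma> (?us @ ?vs) x"
        using \<xi>s(2) \<eta>s(2) \<Sigma>_scale[of "sqrt (1 - t)" \<xi>s] \<Sigma>_scale[of "sqrt t" \<eta>s]
      proof eventually_elim
        case (elim x)
        have "\<Sigma> (?us @ ?vs) x = \<Sigma> ?us x + \<Sigma> ?vs x" by (simp add: \<Sigma>_def)
        then show ?case using elim t by simp
      qed
      moreover have "(\<lambda>x. (1 - t) * k x + t * k' x) \<in> borel_measurable M"
        using K_meas[OF k(1)] K_meas[OF k(2)] by measurable
      moreover have "0 \<le> (1 - t) * k x + t * k' x" for x
        using K_nonneg[OF k(1)] K_nonneg[OF k(2)] t by simp
      ultimately show ?thesis by (intro KI)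
    qed
    show "\<exists>R. \<forall>k\<in>K. prob {x \<in> space M. R < k x} \<le> e" if e: "e > 0" for e
    proof -
      obtain R where R: "\<And>\<xi>s. (\<Sum>\<xi>\<leftarrow>\<xi>s. (norm \<xi>)\<^sup>2) \<le> 1 \<Longrightarrow> prob {x\<in>space M. \<Sigma> \<xi>s x > R} \<le> e"
        using square_sums_bounded_in_measure[OF T_meas add scale tight e] unfolding \<Sigma>_def by blast
      have "prob {x \<in> space M. R < k x} \<le> e" if k: "k \<in> K" for k
      proof -
        obtain \<xi>s where \<xi>s: "Q \<xi>s \<le> 1" "AE x in M. k x = \<Sigma> \<xi>s x" using K_sum[OF k] by blast
        have [measurable]: "k \<in> borel_measurable M" by (rule K_meas[OF k])
        have "prob {x \<in> space M. R < k x} = prob {x\<in>space M. \<Sigma> \<xi>s x > R}"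
          by (rule measure_eq_AE) (use \<xi>s(2) in auto)
        then show ?thesis using R[of \<xi>s] Q_norm[of \<xi>s] \<xi>s(1) by simp
      qed
      then show ?thesis by blast
    qed
    show "k \<circ> \<phi> \<in> K" if \<phi>: "\<phi> \<in> \<theta> ` J" and k: "k \<in> K" for \<phi> k
    proof -
      obtain i where i: "i \<in> J" "\<phi> = \<theta> i" using \<phi> by blast
      obtain \<xi>s where \<xi>s: "Q \<xi>s \<le> 1" "AE x in M. k x = \<Sigma> \<xi>s x" using K_sum[OF k] by blast
      have [measurable]: "k \<in> borel_measurable M" "\<theta> i \<in> measurable M M"
        using K_meas[OF k] \<theta>[OF i(1)] by auto
      have "AE x in distr M M (\<theta> i). k x = \<Sigma> \<xi>s x" using \<theta>[OF i(1)] \<xi>s(2) by metis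
      then have "AE x in M. k (\<theta> i x) = \<Sigma> \<xi>s (\<theta> i x)" by (rule AE_distrD[rotated]) measurable
      then have "AE x in M. (k \<circ> \<theta> i) x = \<Sigma> (map (p i) \<xi>s) x"
        using \<Sigma>_inv[OF i(1), of \<xi>s] by eventually_elim simp
      moreover have "Q (map (p i) \<xi>s) \<le> 1" using Q_inv[OF i(1), of \<xi>s] \<xi>s(1) by simp
      moreover have "k \<circ> \<theta> i \<in> borel_measurable M" by measurable
      moreover have "0 \<le> (k \<circ> \<theta> i) x" for x using K_nonneg[OF k] by simp
      ultimately show ?thesis unfolding i(2) by (intro KI)
    qed
  qed (use \<theta> K_meas K_nonneg in blast)+
  then obtain g where g: "g \<in> borel_measurable M" "AE x in M. 0 < g x"
    and g_inv: "\<And>\<phi>. \<phi> \<in> \<theta> ` J \<Longrightarrow> AE x in M. g (\<phi> x) = g x"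
    and g_K: "\<And>k. k \<in> K \<Longrightarrow> integrable M (\<lambda>x. (g x)\<^sup>2 * k x) \<and> (\<integral>x. (g x)\<^sup>2 * k x \<partial>M) \<le> 1"
    by auto
  have "(\<lambda>x. (T \<xi> x)\<^sup>2) \<in> K" if "q \<xi> \<le> 1" for \<xi>
    using that by (intro KI[of _ "[\<xi>]"]) (auto simp: \<Sigma>_def Q_def)
  then show ?thesis
    using g g_inv[OF imageI] g_K by (intro exI[of _ g]) simp
qed

end

section \<open>Generators of unitary groups as functions\<close>

locale represented_algebra = prob_space m
  for m :: "'x measure" +
  fixes A M :: "('k::chilbert_space \<Rightarrow> 'k) set" and \<tau> :: "('k \<Rightarrow> 'k) \<Rightarrow> complex"
    and \<Phi> :: "('k \<Rightarrow> 'k) \<Rightarrow> 'x \<Rightarrow> complex" and \<Lambda> :: "('k \<Rightarrow> 'k) \<Rightarrow> 'k"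
  assumes ident: "Linfty_identification A \<tau> m \<Phi>"
    and AM: "A \<subseteq> M"
    and id_M: "id \<in> M"
    and cinner_\<Lambda>: "\<And>x y. x \<in> M \<Longrightarrow> y \<in> M \<Longrightarrow> cinner (\<Lambda> x) (\<Lambda> y) = \<tau> (cadjoint x \<circ> y)"
    and mult_\<Lambda>: "\<And>x y. x \<in> M \<Longrightarrow> y \<in> M \<Longrightarrow> x (\<Lambda> y) = \<Lambda> (x \<circ> y)"
    and id_A: "id \<in> A"
    and comp_A: "\<And>a b. a \<in> A \<Longrightarrow> b \<in> A \<Longrightarrow> a \<circ> b \<in> A"
    and lincomb_A: "\<And>a b c. a \<in> A \<Longrightarrow> b \<in> A \<Longrightarrow> (\<lambda>v. c *\<^sub>C a v + b v) \<in> A"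
    and cadjoint_A: "\<And>a. a \<in> A \<Longrightarrow> cadjoint a \<in> A"
begin

lemma \<Phi>_Linfty: "a \<in> A \<Longrightarrow> \<Phi> a \<in> Linfty m"
  and \<Phi>_lincomb: "a \<in> A \<Longrightarrow> b \<in> A \<Longrightarrow> AE x in m. \<Phi> (\<lambda>v. c *\<^sub>C a v + b v) x = c * \<Phi> a x + \<Phi> b x"
  and \<Phi>_comp: "a \<in> A \<Longrightarrow> b \<in> A \<Longrightarrow> AE x in m. \<Phi> (a \<circ> b) x = \<Phi> a x * \<Phi> b x"
  and \<Phi>_cadjoint: "a \<in> A \<Longrightarrow> AE x in m. \<Phi> (cadjoint a) x = cnj (\<Phi> a x)"
  and \<Phi>_inj: "a \<in> A \<Longrightarrow> b \<in> A \<Longrightarrow> AE x in m. \<Phi> a x = \<Phi> b x \<Longrightarrow> a = b"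
  and \<Phi>_surj: "h \<in> Linfty m \<Longrightarrow> \<exists>a\<in>A. AE x in m. \<Phi> a x = h x"
  and \<tau>_eq: "a \<in> A \<Longrightarrow> \<tau> a = (\<integral>x. \<Phi> a x \<partial>m)"
  using ident unfolding Linfty_identification_def by blast+

lemma \<Phi>_measurable [measurable]: "a \<in> A \<Longrightarrow> \<Phi> a \<in> borel_measurable m"
  using \<Phi>_Linfty by (simp add: Linfty_def)

text \<open>Unitality follows from surjectivity and multiplicativity: compose a preimage of the
  constant 1 with \<open>id\<close>.\<close>

lemma \<Phi>_id: "AE x in m. \<Phi> id x = 1"
proof -
  have "(\<lambda>_. 1) \<in> Linfty m" by (auto simp: Linfty_def)
  from \<Phi>_surj[OF this] obtain a where a: "a \<in> A" "AE x in m. \<Phi> a x = 1" by blast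
  show ?thesis using \<Phi>_comp[OF a(1) id_A] a(2) by eventually_elim simp
qed

text \<open>The trace vector, that is, the unit of \<open>M\<close> seen in the Hilbert
  space.\<close>

definition \<Omega> :: 'k where "\<Omega> = \<Lambda> id"

lemma norm_\<Omega>:
  assumes a: "a \<in> A"
  shows "integrable m (\<lambda>x. (cmod (\<Phi> a x))\<^sup>2)" and "(norm (a \<Omega>))\<^sup>2 = (\<integral>x. (cmod (\<Phi> a x))\<^sup>2 \<partial>m)"
proof -
  obtain C where C: "AE x in m. cmod (\<Phi> a x) \<le> C" using \<Phi>_Linfty[OF a] by (auto simp: Linfty_def)
  show "integrable m (\<lambda>x. (cmod (\<Phi> a x))\<^sup>2)"
  proof (rule integrable_const_bound[of _ "C\<^sup>2"])
    show "AE x in m. norm ((cmod (\<Phi> a x))\<^sup>2) \<le> C\<^sup>2"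
      using C by eventually_elim (simp add: power_mono)
  qed (use a in measurable)
  have "a \<Omega> = \<Lambda> a" using mult_\<Lambda>[of a id] a AM id_M by (auto simp: \<Omega>_def)
  then have "of_real ((norm (a \<Omega>))\<^sup>2) = \<tau> (cadjoint a \<circ> a)"
    using cinner_\<Lambda>[of a a] a AM by (simp add: cinner_self[symmetric] subset_iff del: of_real_power)
  also have "\<dots> = (\<integral>x. \<Phi> (cadjoint a \<circ> a) x \<partial>m)"
    by (rule \<tau>_eq) (intro comp_A cadjoint_A a)
  also have "\<dots> = (\<integral>x. complex_of_real ((cmod (\<Phi> a x))\<^sup>2) \<partial>m)"
  proof (rule integral_cong_AE)
    show "AE x in m. \<Phi> (cadjoint a \<circ> a) x = complex_of_real ((cmod (\<Phi> a x))\<^sup>2)"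
      using \<Phi>_comp[OF cadjoint_A[OF a] a] \<Phi>_cadjoint[OF a]
      by eventually_elim (simp add: complex_norm_square[unfolded of_real_power] mult.commute)
  qed (use a comp_A cadjoint_A in measurable)
  also have "\<dots> = of_real (\<integral>x. (cmod (\<Phi> a x))\<^sup>2 \<partial>m)"
    by (rule integral_complex_of_real)
  finally show "(norm (a \<Omega>))\<^sup>2 = (\<integral>x. (cmod (\<Phi> a x))\<^sup>2 \<partial>m)" by (simp only: of_real_eq_iff)
qed

lemma \<Phi>_unitary:
  assumes "u \<in> A" "cadjoint u \<circ> u = id"
  shows "AE x in m. cmod (\<Phi> u x) = 1"
  using \<Phi>_comp[OF cadjoint_A[OF assms(1)] assms(1)] \<Phi>_cadjoint[OF assms(1)] \<Phi>_id
proof eventually_elim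
  case (elim x)
  then have "complex_of_real ((cmod (\<Phi> u x))\<^sup>2) = 1"
    using assms(2) by (simp add: complex_norm_square[unfolded of_real_power] mult.commute)
  then show ?case
    by (metis norm_ge_zero of_real_eq_1_iff power2_eq_1_iff abs_of_nonneg abs_1 abs_minus_cancel)
qed

text \<open>On \<open>{\<bar>f\<bar> \<le> j}\<close> the derivative of \<open>\<Phi> (U t)\<close> at \<open>t = 0\<close> in \<open>L\<^sup>2\<close> is \<open>i f\<close>, because the norm of
  \<open>a \<Omega>\<close> is the \<open>L\<^sup>2\<close> norm of \<open>\<Phi> a\<close>. Writing \<open>\<Phi> (U t)\<close> and \<open>cis (t f)\<close> as \<open>n\<close>-th powers of their
  values at \<open>t / n\<close> then bounds their distance by \<open>n\<close> times an error of order \<open>o (1 / n)\<close>.\<close>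

lemma \<Phi>_exp_generator:
  fixes U :: "real \<Rightarrow> 'k \<Rightarrow> 'k" and f :: "'x \<Rightarrow> real"
  assumes U: "\<And>t. U t \<in> A" "\<And>t. cadjoint (U t) \<circ> U t = id"
    and group: "\<And>s t. U (s + t) = U s \<circ> U t"
    and f [measurable]: "f \<in> borel_measurable m"
    and gen: "\<And>v w. (v, w) \<in> affiliated_op A m \<Phi> (\<lambda>x. complex_of_real (f x)) \<Longrightarrow>
      ((\<lambda>t. (U t v - v) /\<^sub>R t) \<longlongrightarrow> \<i> *\<^sub>C w) (at 0)"
  shows "AE x in m. \<Phi> (U t) x = cis (t * f x)"
proof -
  define e where "e t x = cis (t * f x)" for t x
  have [measurable]: "e t \<in> borel_measurable m" for t unfolding e_def by (simp add: borel_measurable_complex_iff)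
  have [measurable]: "\<Phi> (U t) \<in> borel_measurable m" for t using U(1) by measurable
  have U_pow: "AE x in m. \<Phi> (U (real n * s)) x = \<Phi> (U s) x ^ n" for n s
  proof (induction n)
    case 0
    have "U 0 = id"
    proof -
      have "U 0 \<circ> U 0 = U 0" using group[of 0 0] by simp
      then have "cadjoint (U 0) \<circ> (U 0 \<circ> U 0) = cadjoint (U 0) \<circ> U 0" by simp
      then show ?thesis unfolding comp_assoc[symmetric] U(2) by simp
    qed
    then have "U (real 0 * s) = id" by (simp only: of_nat_0 mult_zero_left)
    show ?case unfolding \<open>U (real 0 * s) = id\<close> power_0 by (rule \<Phi>_id)
  next
    case (Suc n)
    have USuc: "U (real (Suc n) * s) = U s \<circ> U (real n * s)"
      using group[of s "real n * s"] by (simp add: distrib_right add.commute)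
    show ?case unfolding USuc power_Suc using \<Phi>_comp[OF U(1) U(1), of s "real n * s"] Suc
      by eventually_elim (simp only:)
  qed
  have "AE x in m. \<bar>f x\<bar> \<le> real j \<longrightarrow> \<Phi> (U t) x = e t x" for j t
  proof -
    have trunc: "(\<lambda>x. if cmod (complex_of_real (f x)) \<le> real n then complex_of_real (f x) else 0) \<in> Linfty m" for n
      by (auto simp: Linfty_def intro!: exI[of _ "real n"])
    have "\<forall>n. \<exists>a. a \<in> A \<and> (AE x in m. \<Phi> a x = (if cmod (complex_of_real (f x)) \<le> real n then complex_of_real (f x) else 0))"
      using \<Phi>_surj[OF trunc] by blast
    from choice[OF this] obtain a where a: "\<And>n. a n \<in> A"
      "\<And>n. AE x in m. \<Phi> (a n) x = (if cmod (complex_of_real (f x)) \<le> real n then complex_of_real (f x) else 0)"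
      by blast
    \<comment> \<open>\<open>P\<close> is the spectral projection of the set where
      \<open>\<bar>f\<bar> \<le> real j\<close>. The truncations of \<open>f\<close> agree on its
      range from \<open>n = j\<close> on, so \<open>P \<Omega>\<close> lies in the domain of the
      operator and has image \<open>a j \<Omega>\<close>.\<close>
    have "(\<lambda>x. if \<bar>f x\<bar> \<le> real j then 1 else 0) \<in> Linfty m"
      by (auto simp: Linfty_def intro!: exI[of _ 1])
    from \<Phi>_surj[OF this] obtain P where P: "P \<in> A" "AE x in m. \<Phi> P x = (if \<bar>f x\<bar> \<le> real j then 1 else 0)"
      by blast
    have aP: "a n \<circ> P = a j" if "n \<ge> j" for n
    proof (rule \<Phi>_inj)
      show "AE x in m. \<Phi> (a n \<circ> P) x = \<Phi> (a j) x"
        using \<Phi>_comp[OF a(1) P(1), of n] a(2)[of n] a(2)[of j] P(2)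
        by eventually_elim (use that in auto)
    qed (use a P comp_A in auto)
    have "(\<lambda>n. a n (P \<Omega>)) \<longlonglongrightarrow> a j \<Omega>"
      using aP by (intro tendsto_eventually eventually_sequentiallyI[of j]) (metis comp_apply)
    then have "(P \<Omega>, a j \<Omega>) \<in> affiliated_op A m \<Phi> (\<lambda>x. complex_of_real (f x))"
      unfolding affiliated_op_def using a by blast
    from gen[OF this] have der: "((\<lambda>t. (U t (P \<Omega>) - P \<Omega>) /\<^sub>R t) \<longlongrightarrow> \<i> *\<^sub>C a j \<Omega>) (at 0)" .
    \<comment> \<open>\<open>y s\<close> is to be the element of \<open>A\<close> that sends
      \<open>\<Omega>\<close> to the difference quotient minus its limit. It is built by nested
      combinations \<open>c a + b\<close>, the form closed under \<open>lincomb_A\<close>; the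
      coefficient \<open>- \<i> - 1\<close> makes \<open>z\<close> equal to \<open>- \<i>\<close>
      times \<open>a j\<close>.\<close>
    define z where "z = (\<lambda>v. (- \<i> - 1) *\<^sub>C a j v + a j v)"
    define w where "w s = (\<lambda>v. complex_of_real (- 1 / s) *\<^sub>C P v + z v)" for s
    define y where "y s = (\<lambda>v. complex_of_real (1 / s) *\<^sub>C (U s \<circ> P) v + w s v)" for s
    have zA: "z \<in> A" unfolding z_def by (intro lincomb_A a)
    have wA: "w s \<in> A" for s unfolding w_def by (intro lincomb_A P zA)
    have yA: "y s \<in> A" for s unfolding y_def by (intro lincomb_A comp_A U P wA)
    have y\<Omega>: "y s \<Omega> = (U s (P \<Omega>) - P \<Omega>) /\<^sub>R s - \<i> *\<^sub>C a j \<Omega>" for s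
    proof -
      have "z \<Omega> = - (\<i> *\<^sub>C a j \<Omega>)"
        using scaleC_add_left[of "- \<i> - 1" 1 "a j \<Omega>"] scaleC_of_real[of 1 "a j \<Omega>"]
        by (simp add: z_def scaleC_minus_left)
      then show ?thesis
        unfolding y_def w_def scaleC_of_real by (simp add: scaleR_diff_right divide_inverse)
    qed
    have y_lim: "((\<lambda>s. (norm (y s \<Omega>))\<^sup>2) \<longlongrightarrow> 0) (at 0)"
      using tendsto_power[OF tendsto_norm_zero[OF LIM_zero[OF der]], of 2] by (simp add: y\<Omega>)
    \<comment> \<open>Where \<open>\<bar>f\<bar> \<le> real j\<close>, the function
      \<open>s * \<Phi> (y s)\<close> is the remainder of the first-order expansion of
      \<open>\<Phi> (U s)\<close>.\<close>
    have \<Phi>y: "AE x in m. \<bar>f x\<bar> \<le> real j \<longrightarrow> s * \<Phi> (y s) x = \<Phi> (U s) x - 1 - \<i> * (s * f x)" if "s \<noteq> 0" for s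
      using \<Phi>_lincomb[OF comp_A[OF U(1) P(1)] wA, of "complex_of_real (1 / s)" s s]
        \<Phi>_comp[OF U(1) P(1), of s] \<Phi>_lincomb[OF P(1) zA, of "complex_of_real (- 1 / s)"]
        \<Phi>_lincomb[OF a(1) a(1), of "- \<i> - 1" j j] a(2)[of j] P(2)
      unfolding y_def[symmetric] w_def[symmetric] z_def[symmetric]
    proof eventually_elim
      case (elim x)
      then show ?case using that by (auto simp: field_simps)
    qed
    let ?D = "\<lambda>t x. if \<bar>f x\<bar> \<le> real j then (cmod (\<Phi> (U t) x - e t x))\<^sup>2 else 0"
    define bd where "bd s = 2 * t\<^sup>2 * (norm (y s \<Omega>))\<^sup>2 + 2 * t\<^sup>2 * s\<^sup>2 * real j ^ 4" for s
    have D_int: "integrable m (?D t)"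
    proof (rule integrable_const_bound[of _ 4])
      show "AE x in m. norm (?D t x) \<le> 4"
        using \<Phi>_unitary[OF U, of t]
      proof eventually_elim
        case (elim x)
        have "cmod (\<Phi> (U t) x - e t x) \<le> 2"
          using norm_triangle_ineq4[of "\<Phi> (U t) x" "e t x"] elim by (simp add: e_def)
        then show ?case using power_mono[of "cmod (\<Phi> (U t) x - e t x)" 2 2] by simp
      qed
    qed measurable
    have D_le: "(\<integral>x. ?D t x \<partial>m) \<le> bd (t / real n)" if n: "n > 0" and t: "t \<noteq> 0" for n
    proof -
      define s where "s = t / real n"
      have s: "s \<noteq> 0" "real n * s = t" using n t by (auto simp: s_def)
      have pw: "AE x in m. ?D t x \<le> 2 * t\<^sup>2 * (cmod (\<Phi> (y s) x))\<^sup>2 + 2 * t\<^sup>2 * s\<^sup>2 * real j ^ 4"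
        using U_pow[of n s] \<Phi>_unitary[OF U, of s] \<Phi>y[OF s(1)]
      proof eventually_elim
        case (elim x)
        show ?case
        proof (cases "\<bar>f x\<bar> \<le> real j")
          case True
          have en: "e t x = e s x ^ n"
            unfolding e_def Complex.DeMoivre using s(2) by (simp add: mult.assoc[symmetric])
          have "cmod (\<Phi> (U t) x - e t x) \<le> real n * cmod (\<Phi> (U s) x - e s x)"
            using norm_power_diff[of "\<Phi> (U s) x" "e s x" n] elim(1,2) s(2) en by (simp add: e_def)
          \<comment> \<open>Both \<open>\<Phi> (U s) x\<close> and \<open>e s x\<close> have the
            expansion \<open>1 + \<i> * (s * f x)\<close> up to a remainder: the first has
            \<open>s * \<Phi> (y s) x\<close>, the second \<open>?r\<close>. Since
            \<open>n * s = t\<close>, the factor \<open>n\<close> then cancels one power of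
            \<open>s\<close>.\<close>
          also have "\<dots> \<le> real n * (\<bar>s\<bar> * cmod (\<Phi> (y s) x) + s\<^sup>2 * (real j)\<^sup>2)"
          proof (rule mult_left_mono)
            let ?r = "iexp (s * f x) - (\<Sum>k\<le>1. (\<i> * complex_of_real (s * f x)) ^ k / fact k)"
            have "cmod (\<Phi> (U s) x - e s x) = cmod (s * \<Phi> (y s) x - ?r)"
              using elim(3) True by (simp add: e_def cis_conv_exp)
            also have "\<dots> \<le> cmod (s * \<Phi> (y s) x) + cmod ?r" by (rule norm_triangle_ineq4)
            also have "cmod ?r \<le> \<bar>s * f x\<bar> ^ Suc 1 / fact (Suc 1)" by (rule iexp_approx1)
            also have "\<dots> \<le> (s * f x)\<^sup>2" by (simp add: numeral_2_eq_2[symmetric])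
            also have "\<dots> \<le> s\<^sup>2 * (real j)\<^sup>2"
              unfolding power_mult_distrib using True abs_le_square_iff[of "f x" "real j"]
              by (intro mult_left_mono) auto
            finally show "cmod (\<Phi> (U s) x - e s x) \<le> \<bar>s\<bar> * cmod (\<Phi> (y s) x) + s\<^sup>2 * (real j)\<^sup>2"
              by (simp add: norm_mult)
          qed simp
          also have "\<dots> = \<bar>t\<bar> * (cmod (\<Phi> (y s) x) + \<bar>s\<bar> * (real j)\<^sup>2)"
            unfolding s(2)[symmetric] by (simp add: abs_mult algebra_simps power2_eq_square abs_mult_self_eq)
          finally have "(cmod (\<Phi> (U t) x - e t x))\<^sup>2 \<le> (\<bar>t\<bar> * (cmod (\<Phi> (y s) x) + \<bar>s\<bar> * (real j)\<^sup>2))\<^sup>2"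
            by (intro power_mono) auto
          also have "\<dots> = t\<^sup>2 * (cmod (\<Phi> (y s) x) + \<bar>s\<bar> * (real j)\<^sup>2)\<^sup>2" by (simp add: power_mult_distrib)
          also have "\<dots> \<le> t\<^sup>2 * (2 * (cmod (\<Phi> (y s) x))\<^sup>2 + 2 * (\<bar>s\<bar> * (real j)\<^sup>2)\<^sup>2)"
            using zero_le_power2[of "cmod (\<Phi> (y s) x) - \<bar>s\<bar> * (real j)\<^sup>2"]
            by (intro mult_left_mono) (auto simp: power2_sum power2_diff)
          finally show ?thesis using True by (simp add: power_mult_distrib algebra_simps flip: power_mult)
        qed simp
      qed
      have "(\<integral>x. ?D t x \<partial>m) \<le> (\<integral>x. 2 * t\<^sup>2 * (cmod (\<Phi> (y s) x))\<^sup>2 + 2 * t\<^sup>2 * s\<^sup>2 * real j ^ 4 \<partial>m)"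
        using norm_\<Omega>(1)[OF yA[of s]] by (intro integral_mono_AE D_int pw) auto
      also have "\<dots> = bd s"
        using norm_\<Omega>[OF yA[of s]] by (simp add: bd_def prob_space)
      finally show ?thesis by (simp add: s_def)
    qed
    show "AE x in m. \<bar>f x\<bar> \<le> real j \<longrightarrow> \<Phi> (U t) x = e t x"
    proof (cases "t = 0")
      case True
      then show ?thesis using U_pow[of 0 0] by (auto simp: e_def)
    next
      case False
      have bd0: "(bd \<longlongrightarrow> 2 * t\<^sup>2 * 0 + 2 * t\<^sup>2 * 0\<^sup>2 * real j ^ 4) (at 0)"
        unfolding bd_def by (intro tendsto_intros y_lim)
      \<comment> \<open>The steps \<open>t / real (Suc n)\<close> must avoid 0, hence
        \<open>Suc n\<close> and the separate case \<open>t = 0\<close>.\<close>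
      have "filterlim (\<lambda>n. t / real (Suc n)) (at 0) sequentially"
        unfolding filterlim_at using False LIMSEQ_Suc[OF lim_const_over_n[of t]] by simp
      from filterlim_compose[OF bd0 this]
      have "(\<integral>x. ?D t x \<partial>m) \<le> 0"
        by (intro LIMSEQ_le_const[of "\<lambda>n. bd (t / real (Suc n))"]) (use D_le[OF _ False] in \<open>auto simp del: of_nat_Suc\<close>)
      moreover have "(\<integral>x. ?D t x \<partial>m) \<ge> 0" by (rule integral_nonneg_AE) auto
      ultimately have "AE x in m. ?D t x = 0"
        by (subst integral_nonneg_eq_0_iff_AE[OF D_int, symmetric]) auto
      then show ?thesis by eventually_elim (auto split: if_splits)
    qed
  qed
  then have "AE x in m. \<forall>j. \<bar>f x\<bar> \<le> real j \<longrightarrow> \<Phi> (U t) x = e t x" 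
    by (subst AE_all_countable) blast
  then show ?thesis
  proof eventually_elim
    case (elim x)
    then show ?case using real_arch_simple[of "\<bar>f x\<bar>"] by (auto simp: e_def)
  qed
qed

end

section \<open>Functions compared and estimated through their exponentials\<close>

context prob_space
begin

text \<open>Each \<open>t\<close> has its own null set, so only the countably many values
  \<open>1 / Suc n\<close> are used. At a given point some \<open>n\<close> makes the difference of
  the two functions, divided by \<open>Suc n\<close>, smaller than 1; being a multiple of
  \<open>2 * pi\<close>, it is 0.\<close>

lemma AE_eq_if_cis_eq:
  fixes f g :: "'a \<Rightarrow> real"
  assumes "\<And>t. AE x in M. cis (t * f x) = cis (t * g x)"
  shows "AE x in M. f x = g x"
proof -
  have "AE x in M. \<forall>n. cis (1 / real (Suc n) * f x) = cis (1 / real (Suc n) * g x)"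
    by (subst AE_all_countable) (use assms in blast)
  then show ?thesis
  proof eventually_elim
    case (elim x)
    obtain n where n: "\<bar>f x - g x\<bar> < real n" using reals_Archimedean2 by blast
    define d where "d = (f x - g x) / real (Suc n)"
    have "cis d = cis (1 / real (Suc n) * f x) / cis (1 / real (Suc n) * g x)"
      by (simp add: cis_divide d_def diff_divide_distrib)
    also have "\<dots> = 1" using elim[rule_format, of n] by simp
    finally have "cos d = 1" by (simp add: complex_eq_iff)
    from this[unfolded cos_one_2pi_int] obtain k :: int where k: "d = real_of_int k * 2 * pi" by blast
    have "\<bar>d\<bar> < 1" using n by (simp add: d_def)
    then have lt: "\<bar>real_of_int k\<bar> * (2 * pi) < 1" using k by (simp add: abs_mult)
    have "k = 0"
    proof (rule ccontr)
      assume "k \<noteq> 0"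
      then have "1 \<le> \<bar>real_of_int k\<bar>" by linarith
      then have "1 * (2 * pi) \<le> \<bar>real_of_int k\<bar> * (2 * pi)" by (intro mult_right_mono) auto
      then show False using lt pi_gt3 by linarith
    qed
    then show ?case using k by (simp add: d_def)
  qed
qed

text \<open>The truncation inequality for characteristic functions: averaging
  \<open>1 - cos (t * y)\<close> over \<open>t\<close> in [0, 1] gives \<open>1 - sin y / y\<close>,
  which is at least 1 / 2 for \<open>\<bar>y\<bar> > 2\<close>.\<close>

lemma prob_large_le:
  fixes f :: "'a \<Rightarrow> real"
  assumes [measurable]: "f \<in> borel_measurable M"
    and le: "\<And>t. 0 \<le> t \<Longrightarrow> t \<le> 1 \<Longrightarrow> (\<integral>x. 1 - cos (t * f x) \<partial>M) \<le> e"
  shows "prob {x\<in>space M. \<bar>f x\<bar> > 2} \<le> 2 * e"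
proof -
  define N where "N = restrict_space lborel {0..1::real}"
  have spN: "space N = {0..1}" by (simp add: N_def space_restrict_space)
  have N: "prob_space N"
    by (rule prob_spaceI) (simp add: N_def space_restrict_space emeasure_restrict_space)
  have id_N [measurable]: "(\<lambda>t. t) \<in> borel_measurable N"
    unfolding N_def by (intro measurable_restrict_space1) auto
  interpret N: prob_space N by (rule N)
  interpret P: pair_prob_space M N ..
  have c: "0 \<le> 1 - cos y" "1 - cos y \<le> 2" for y :: real
    using cos_le_one[of y] cos_ge_minus_one[of y] by linarith+
  have int: "integrable (M \<Otimes>\<^sub>M N) (\<lambda>(x, t). 1 - cos (t * f x))"
    by (rule P.integrable_const_bound[of _ 2]) (use c in auto)
  \<comment> \<open>At \<open>y = 0\<close> the formula fails: division by zero makes the right side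
    1, whereas the integral is 0.\<close>
  have inner: "(\<integral>t. 1 - cos (t * y) \<partial>N) = 1 - sin y / y" if "y \<noteq> 0" for y
  proof -
    have "(\<integral>t. 1 - cos (t * y) \<partial>N) = (\<integral>t. indicator {0..1} t *\<^sub>R (1 - cos (t * y)) \<partial>lborel)"
      unfolding N_def by (subst integral_restrict_space) auto
    also have "\<dots> = (1 - sin (1 * y) / y) - (0 - sin (0 * y) / y)"
    proof (rule integral_FTC_Icc)
      show "((\<lambda>t. t - sin (t * y) / y) has_vector_derivative 1 - cos (t * y)) (at t within {0..1})" for t
        using that unfolding has_real_derivative_iff_has_vector_derivative[symmetric]
        by (auto intro!: derivative_eq_intros)
      show "continuous_on {0..1} (\<lambda>t. 1 - cos (t * y))" by (intro continuous_intros)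
    qed simp
    finally show ?thesis by simp
  qed
  have "1 / 2 * prob {x\<in>space M. \<bar>f x\<bar> > 2} = (\<integral>x. indicator {x\<in>space M. \<bar>f x\<bar> > 2} x *\<^sub>R (1 / 2) \<partial>M)"
    by simp
  also have "\<dots> \<le> (\<integral>x. (\<integral>t. 1 - cos (t * f x) \<partial>N) \<partial>M)"
  proof (rule integral_mono)
    show "integrable M (\<lambda>x. indicator {x\<in>space M. \<bar>f x\<bar> > 2} x *\<^sub>R (1 / 2 :: real))"
      by (rule integrable_const_bound[of _ 1]) (auto simp: indicator_def)
    show "integrable M (\<lambda>x. \<integral>t. 1 - cos (t * f x) \<partial>N)"
      using P.integrable_fst'[OF int] by simp
    show "indicator {x\<in>space M. \<bar>f x\<bar> > 2} x *\<^sub>R (1 / 2) \<le> (\<integral>t. 1 - cos (t * f x) \<partial>N)" for x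
    proof (cases "\<bar>f x\<bar> > 2")
      case True
      have "sin (f x) / f x \<le> \<bar>sin (f x)\<bar> / \<bar>f x\<bar>" by (metis abs_divide abs_ge_self)
      also have "\<dots> \<le> 1 / 2" using True by (intro frac_le) auto
      finally show ?thesis using True inner[of "f x"] by (auto simp: indicator_def)
    next
      case False
      then show ?thesis using c by (auto intro!: integral_nonneg_AE)
    qed
  qed
  also have "\<dots> = (\<integral>t. (\<integral>x. 1 - cos (t * f x) \<partial>M) \<partial>N)"
    using P.Fubini_integral[OF int] by simp
  also have "\<dots> \<le> (\<integral>t. e \<partial>N)"
  proof (rule integral_mono)
    show "integrable N (\<lambda>t. \<integral>x. 1 - cos (t * f x) \<partial>M)"
      using P.integrable_snd[OF int] by simp
    show "(\<integral>x. 1 - cos (t * f x) \<partial>M) \<le> e" if "t \<in> space N" for t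
      using that by (intro le) (auto simp: spN)
  qed simp
  also have "\<dots> = e" by (simp add: N.prob_space)
  finally show ?thesis by simp
qed

end

section \<open>The unitaries of the translation group\<close>

lemma unitary_left_inverse_unique:
  assumes "u \<in> carrier (unitary_group M)" "v \<circ> u = id"
  shows "cadjoint u = v"
proof -
  have "u \<circ> cadjoint u = id" using assms(1) by (simp add: unitary_group_def)
  then have "(v \<circ> u) \<circ> cadjoint u = v" by (simp add: comp_assoc)
  then show ?thesis using assms(2) by simp
qed

locale semidirect_embedding = group \<Gamma>
  for \<Gamma> :: "('g, 'b) monoid_scheme" (structure) +
  fixes \<pi> :: "'g \<Rightarrow> 'h::chilbert_space \<Rightarrow> 'h" and M :: "('k::chilbert_space \<Rightarrow> 'k) set"
    and \<alpha> :: "'h \<times> 'g \<Rightarrow> 'k \<Rightarrow> 'k"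
  assumes rep: "uniformly_bounded_rep \<Gamma> \<pi>" and M: "von_neumann_algebra M"
    and emb: "closed_subgroup_embedding \<Gamma> \<pi> M \<alpha>"
begin

lemma \<pi>_clinear: "s \<in> carrier \<Gamma> \<Longrightarrow> bounded_clinear (\<pi> s)"
  using rep by (auto simp: uniformly_bounded_rep_def hom_def GL_group_def)

lemma \<pi>_linear: "s \<in> carrier \<Gamma> \<Longrightarrow> bounded_linear (\<pi> s)"
  using \<pi>_clinear by (simp add: bounded_clinear_def)

lemma \<pi>_mult: "s \<in> carrier \<Gamma> \<Longrightarrow> t \<in> carrier \<Gamma> \<Longrightarrow> \<pi> (s \<otimes> t) = \<pi> s \<circ> \<pi> t"
  using rep by (auto simp: uniformly_bounded_rep_def hom_def GL_group_def)

text \<open>\<open>hom\<close> demands multiplicativity only; an invertible idempotent is the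
  identity.\<close>

lemma \<pi>_one: "\<pi> \<one> = id"
proof -
  have "\<pi> \<one> \<in> carrier GL_group" using rep by (auto simp: uniformly_bounded_rep_def hom_def)
  then obtain g where "g \<circ> \<pi> \<one> = id" by (auto simp: GL_group_def)
  then have "id = g \<circ> (\<pi> \<one> \<circ> \<pi> \<one>)" using \<pi>_mult[of \<one> \<one>] by simp
  then show ?thesis using \<open>g \<circ> \<pi> \<one> = id\<close> by (simp flip: comp_assoc)
qed

lemma \<alpha>_mult:
  assumes "s \<in> carrier \<Gamma>" "t \<in> carrier \<Gamma>"
  shows "\<alpha> (\<xi> + \<pi> s \<eta>, s \<otimes> t) = \<alpha> (\<xi>, s) \<circ> \<alpha> (\<eta>, t)"
proof -
  have "\<alpha> \<in> hom (semidirect \<Gamma> \<pi>) (unitary_group M\<lparr>carrier := \<alpha> ` carrier (semidirect \<Gamma> \<pi>)\<rparr>)"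
    using emb by (simp add: closed_subgroup_embedding_def Let_def iso_def)
  from hom_mult[OF this, of "(\<xi>, s)" "(\<eta>, t)"] show ?thesis
    using assms by (simp add: semidirect_def unitary_group_def)
qed

lemma \<alpha>_unitary: "s \<in> carrier \<Gamma> \<Longrightarrow> \<alpha> (\<xi>, s) \<in> carrier (unitary_group M)"
  using emb subgroup.subset by (fastforce simp: closed_subgroup_embedding_def Let_def semidirect_def)

lemma \<alpha>_M: "s \<in> carrier \<Gamma> \<Longrightarrow> \<alpha> (\<xi>, s) \<in> M"
  and cadjoint_\<alpha>: "s \<in> carrier \<Gamma> \<Longrightarrow> cadjoint (\<alpha> (\<xi>, s)) \<circ> \<alpha> (\<xi>, s) = id"
  using \<alpha>_unitary[of s \<xi>] by (simp_all add: unitary_group_def)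

lemma \<alpha>_one: "\<alpha> (0, \<one>) = id"
proof -
  have "\<alpha> (0, \<one>) = \<alpha> (0, \<one>) \<circ> \<alpha> (0, \<one>)" using \<alpha>_mult[of \<one> \<one> 0 0] by (simp add: \<pi>_one)
  then have "cadjoint (\<alpha> (0, \<one>)) \<circ> \<alpha> (0, \<one>) = (cadjoint (\<alpha> (0, \<one>)) \<circ> \<alpha> (0, \<one>)) \<circ> \<alpha> (0, \<one>)"
    by (metis comp_assoc)
  then show ?thesis by (simp add: cadjoint_\<alpha>)
qed

definition U :: "'h \<Rightarrow> 'k \<Rightarrow> 'k" where "U \<xi> = \<alpha> (\<xi>, \<one>)"

lemma U_add: "U (\<xi> + \<eta>) = U \<xi> \<circ> U \<eta>"
  using \<alpha>_mult[of \<one> \<one> \<xi> \<eta>] by (simp add: U_def \<pi>_one)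

lemma cadjoint_U: "cadjoint (U \<xi>) = U (- \<xi>)"
proof (rule unitary_left_inverse_unique)
  show "U \<xi> \<in> carrier (unitary_group M)" unfolding U_def by (rule \<alpha>_unitary) simp
  show "U (- \<xi>) \<circ> U \<xi> = id" by (metis U_add U_def \<alpha>_one add.left_inverse)
qed

lemma U_conj:
  assumes s: "s \<in> carrier \<Gamma>"
  shows "\<alpha> (0, s) \<circ> U \<xi> \<circ> cadjoint (\<alpha> (0, s)) = U (\<pi> s \<xi>)"
proof -
  have \<pi>0: "\<pi> t 0 = 0" if "t \<in> carrier \<Gamma>" for t
    using linear_0[OF bounded_linear.linear[OF \<pi>_linear[OF that]]] .
  have "\<alpha> (0, inv s) \<circ> \<alpha> (0, s) = id"
    using \<alpha>_mult[of "inv s" s 0 0] s \<pi>0[of "inv s"] \<alpha>_one by simp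
  then have "cadjoint (\<alpha> (0, s)) = \<alpha> (0, inv s)"
    by (rule unitary_left_inverse_unique[OF \<alpha>_unitary[OF s]])
  moreover have "\<alpha> (0, s) \<circ> U \<xi> = \<alpha> (\<pi> s \<xi>, s)"
    using \<alpha>_mult[of s \<one> 0 \<xi>] s by (simp add: U_def)
  moreover have "\<alpha> (\<pi> s \<xi>, s) \<circ> \<alpha> (0, inv s) = U (\<pi> s \<xi>)"
    using \<alpha>_mult[of s "inv s" "\<pi> s \<xi>" 0] s \<pi>0[OF s] by (simp add: U_def)
  ultimately show ?thesis by simp
qed

text \<open>The strong topology is a product topology, so evaluation at \<open>v\<close> is a
  coordinate projection.\<close>

lemma continuous_U: "continuous_on UNIV (\<lambda>\<xi>. U \<xi> v)"
proof -
  let ?R = "\<alpha> ` carrier (semidirect \<Gamma> \<pi>)"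
  have "homeomorphic_map (prod_topology euclidean (discrete_topology (carrier \<Gamma>))) (sot_on ?R) \<alpha>"
    using emb by (simp add: closed_subgroup_embedding_def Let_def)
  then have "continuous_map (prod_topology euclidean (discrete_topology (carrier \<Gamma>)))
      (product_topology (\<lambda>_. euclidean) UNIV) \<alpha>"
    unfolding sot_on_def using homeomorphic_imp_continuous_map continuous_map_into_fulltopology by blast
  moreover have "continuous_map euclidean (prod_topology euclidean (discrete_topology (carrier \<Gamma>))) (\<lambda>\<xi> :: 'h. (\<xi>, \<one>))"
    by (intro continuous_map_pairedI) (auto simp: continuous_map_const)
  ultimately have "continuous_map euclidean (product_topology (\<lambda>_. euclidean) UNIV) (\<alpha> \<circ> (\<lambda>\<xi> :: 'h. (\<xi>, \<one>)))"
    by (rule continuous_map_compose[rotated])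
  then have "continuous_map euclidean euclidean (\<lambda>\<xi>. U \<xi> v)"
    unfolding continuous_map_componentwise_UNIV by (simp add: U_def comp_def)
  then show ?thesis by simp
qed

section \<open>The von Neumann algebra of the translations\<close>

abbreviation A :: "('k \<Rightarrow> 'k) set" where "A \<equiv> translation_algebra \<Gamma> \<alpha>"

lemma A_eq: "A = commutant (commutant (range U))"
  by (simp add: translation_algebra_def U_def)

lemma U_clinear: "bounded_clinear (U \<xi>)"
  using M \<alpha>_M[of \<one> \<xi>] by (simp add: von_neumann_algebra_def U_def)

lemma U_A: "U \<xi> \<in> A"
  unfolding A_eq using subset_double_commutant[of "range U"] U_clinear by blast

lemma A_subset: "A \<subseteq> M"
proof -
  have "range U \<subseteq> M" using \<alpha>_M by (auto simp: U_def)
  then have "A \<subseteq> commutant (commutant M)" unfolding A_eq by (intro commutant_antimono)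
  then show ?thesis using M by (simp add: von_neumann_algebra_def)
qed

text \<open>The range of \<open>U\<close> is closed under adjoints by \<open>cadjoint_U\<close>,
  hence so are its commutant and its double commutant.\<close>

lemma cadjoint_A: "a \<in> A \<Longrightarrow> cadjoint a \<in> A"
  unfolding A_eq
proof (rule cadjoint_in_commutant)
  fix z assume "z \<in> commutant (range U)"
  then show "bounded_clinear z \<and> cadjoint z \<in> commutant (range U)"
    using U_clinear by (auto intro!: cadjoint_in_commutant simp: commutantD(1) cadjoint_U)
qed

section \<open>The invariant norm\<close>

definition orbit_norm :: "'h \<Rightarrow> real" where
  "orbit_norm \<xi> = (SUP s\<in>carrier \<Gamma>. norm (\<pi> s \<xi>))"

lemma orbit_norm_bound: "\<exists>C>0. \<forall>s\<in>carrier \<Gamma>. \<forall>\<xi>. norm (\<pi> s \<xi>) \<le> C * norm \<xi>"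
proof -
  obtain C where C: "\<And>s. s \<in> carrier \<Gamma> \<Longrightarrow> onorm (\<pi> s) \<le> C"
    using rep by (auto simp: uniformly_bounded_rep_def)
  \<comment> \<open>\<open>max 1 C\<close> makes the constant positive, since the final weight is
    divided by its square.\<close>
  have "norm (\<pi> s \<xi>) \<le> max 1 C * norm \<xi>" if "s \<in> carrier \<Gamma>" for s \<xi>
  proof -
    have "norm (\<pi> s \<xi>) \<le> onorm (\<pi> s) * norm \<xi>" by (rule onorm[OF \<pi>_linear[OF that]])
    also have "\<dots> \<le> max 1 C * norm \<xi>" using C[OF that] by (intro mult_right_mono) auto
    finally show ?thesis .
  qed
  then show ?thesis by (intro exI[of _ "max 1 C"]) auto
qed

lemma orbit_norm_upper: "s \<in> carrier \<Gamma> \<Longrightarrow> norm (\<pi> s \<xi>) \<le> orbit_norm \<xi>"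
proof -
  obtain C where "\<forall>s\<in>carrier \<Gamma>. \<forall>\<xi>. norm (\<pi> s \<xi>) \<le> C * norm \<xi>" using orbit_norm_bound by blast
  then have "bdd_above ((\<lambda>s. norm (\<pi> s \<xi>)) ` carrier \<Gamma>)" by (auto intro!: bdd_aboveI2)
  then show "s \<in> carrier \<Gamma> \<Longrightarrow> norm (\<pi> s \<xi>) \<le> orbit_norm \<xi>"
    unfolding orbit_norm_def by (rule cSUP_upper[rotated])
qed

lemma orbit_norm_least: "(\<And>s. s \<in> carrier \<Gamma> \<Longrightarrow> norm (\<pi> s \<xi>) \<le> c) \<Longrightarrow> orbit_norm \<xi> \<le> c"
  unfolding orbit_norm_def using one_closed by (intro cSUP_least) auto

lemma norm_le_orbit_norm: "norm \<xi> \<le> orbit_norm \<xi>"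
  using orbit_norm_upper[of \<one> \<xi>] by (simp add: \<pi>_one)

lemma orbit_norm_scale: "orbit_norm (c *\<^sub>R \<xi>) \<le> \<bar>c\<bar> * orbit_norm \<xi>"
  by (rule orbit_norm_least)
    (simp add: linear_scale[OF bounded_linear.linear[OF \<pi>_linear]] orbit_norm_upper mult_left_mono)

lemma orbit_norm_\<pi>: "t \<in> carrier \<Gamma> \<Longrightarrow> orbit_norm (\<pi> t \<xi>) \<le> orbit_norm \<xi>"
  by (rule orbit_norm_least) (metis \<pi>_mult comp_apply m_closed orbit_norm_upper)

end

theorem theorem3p5:
  fixes \<Gamma> :: "('g, 'b) monoid_scheme"
    and \<pi> :: "'g \<Rightarrow> 'h::chilbert_space \<Rightarrow> 'h"
    and M :: "('k::chilbert_space \<Rightarrow> 'k) set"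
    and \<tau> :: "('k \<Rightarrow> 'k) \<Rightarrow> complex"
    and \<alpha> :: "'h \<times> 'g \<Rightarrow> 'k \<Rightarrow> 'k"
    and S :: "'h \<Rightarrow> ('k \<times> 'k) set"
    and m :: "'x::metric_space measure"
    and \<Phi> :: "('k \<Rightarrow> 'k) \<Rightarrow> 'x \<Rightarrow> complex"
    and act :: "'g \<Rightarrow> 'x \<Rightarrow> 'x"
    and T :: "'h \<Rightarrow> 'x \<Rightarrow> real"
  assumes "group \<Gamma>" and "countable (carrier \<Gamma>)"
    and "separable_space (euclidean :: 'h topology)"
    and "uniformly_bounded_rep \<Gamma> \<pi>"
    and "II1_factor M" and "separable_predual M"
    and "normal_faithful_tracial_state M \<tau>" and "acts_on_L2 M \<tau>"
    and "closed_subgroup_embedding \<Gamma> \<pi> M \<alpha>"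
    and "\<And>\<xi>. selfadjoint (S \<xi>) \<and> affiliated (S \<xi>) M
            \<and> is_exp_i (S \<xi>) (\<lambda>t. \<alpha> (t *\<^sub>R \<xi>, \<one>\<^bsub>\<Gamma>\<^esub>))"
    and "compact (UNIV :: 'x set)" and "prob_space m" and "sets m = sets borel"
    and "Linfty_identification (translation_algebra \<Gamma> \<alpha>) \<tau> m \<Phi>"
    and "measure_preserving_action \<Gamma> m act"
    and "\<And>s a. s \<in> carrier \<Gamma> \<Longrightarrow> a \<in> translation_algebra \<Gamma> \<alpha> \<Longrightarrow>
           AE x in m. \<Phi> (\<alpha> (0, s) \<circ> a \<circ> cadjoint (\<alpha> (0, s))) x = translate \<Gamma> act s (\<Phi> a) x"
    and "\<And>\<xi>. T \<xi> \<in> borel_measurable m \<and>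
            affiliated_op (translation_algebra \<Gamma> \<alpha>) m \<Phi> (\<lambda>x. complex_of_real (T \<xi> x)) = S \<xi>"
  shows "\<exists>\<phi> :: 'x \<Rightarrow> real. \<phi> \<in> borel_measurable m
    \<and> (AE x in m. \<phi> x > 0)
    \<and> (\<forall>s\<in>carrier \<Gamma>. AE x in m. translate \<Gamma> act s \<phi> x = \<phi> x)
    \<and> (\<forall>\<xi>. integrable m (\<lambda>x. \<phi> x * (T \<xi> x)\<^sup>2) \<and> (\<integral>x. \<phi> x * (T \<xi> x)\<^sup>2 \<partial>m) \<le> (norm \<xi>)\<^sup>2)
    \<and> (let \<psi> = (\<lambda>x. \<phi> x powr (- 1 / 2));
            T' = (\<lambda>\<xi> x. \<phi> x powr (1 / 2) * T \<xi> x)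
        in (\<forall>s\<in>carrier \<Gamma>. AE x in m. translate \<Gamma> act s \<psi> x = \<psi> x)
           \<and> (\<forall>\<xi>. T' \<xi> \<in> L2_real m)
           \<and> (\<forall>s\<in>carrier \<Gamma>. \<forall>\<xi>. AE x in m. T' (\<pi> s \<xi>) x = translate \<Gamma> act s (T' \<xi>) x)
           \<and> (\<forall>\<xi>. AE x in m. T \<xi> x = \<psi> x * T' \<xi> x))"
proof -

  \<comment> \<open>The algebra of translations as functions\<close>
  have vN: "von_neumann_algebra M" using assms(5) by (simp add: II1_factor_def)
  interpret E: semidirect_embedding \<Gamma> \<pi> M \<alpha>
    by (intro semidirect_embedding.intro semidirect_embedding_axioms.intro assms(1,4,9) vN)
  interpret prob_space m by (rule assms(12))
  obtain \<Lambda> :: "('k \<Rightarrow> 'k) \<Rightarrow> 'k" where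
    \<Lambda>: "\<And>x y. x \<in> M \<Longrightarrow> y \<in> M \<Longrightarrow> cinner (\<Lambda> x) (\<Lambda> y) = \<tau> (cadjoint x \<circ> y)"
      "\<And>x y. x \<in> M \<Longrightarrow> y \<in> M \<Longrightarrow> x (\<Lambda> y) = \<Lambda> (x \<circ> y)"
    using assms(8) unfolding acts_on_L2_def by blast
  have id_M: "id \<in> M" using vN id_in_commutant unfolding von_neumann_algebra_def by metis
  interpret R: represented_algebra m E.A M \<tau> \<Phi> \<Lambda>
  proof
    show "(\<lambda>v. c *\<^sub>C a v + b v) \<in> E.A" if "a \<in> E.A" "b \<in> E.A" for a b c
      using that commutantD(1) unfolding E.A_eq by (intro lincomb_in_commutant) blast+
    show "a \<circ> b \<in> E.A" if "a \<in> E.A" "b \<in> E.A" for a b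
      using that unfolding E.A_eq by (rule comp_in_commutant)
    show "id \<in> E.A" unfolding E.A_eq by (rule id_in_commutant)
  qed (use assms(14) E.A_subset E.cadjoint_A id_M \<Lambda> in auto)

  \<comment> \<open>Linearity, equivariance and continuity of \<open>T\<close>\<close>
  have T_meas [measurable]: "T \<xi> \<in> borel_measurable m" for \<xi> using assms(17) by blast
  \<comment> \<open>\<open>S \<xi>\<close> is both the generator of the unitary group along
    \<open>\<xi>\<close> and the operator of the function \<open>T \<xi>\<close>; this links the
    two.\<close>
  have \<Phi>U: "AE x in m. \<Phi> (E.U (t *\<^sub>R \<xi>)) x = cis (t * T \<xi> x)" for t \<xi>
  proof (rule R.\<Phi>_exp_generator)
    show "E.U (t *\<^sub>R \<xi>) \<in> E.A" for t by (rule E.U_A)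
    show "cadjoint (E.U (t *\<^sub>R \<xi>)) \<circ> E.U (t *\<^sub>R \<xi>) = id" for t
      unfolding E.U_def by (rule E.cadjoint_\<alpha>) simp
    show "E.U ((s + t) *\<^sub>R \<xi>) = E.U (s *\<^sub>R \<xi>) \<circ> E.U (t *\<^sub>R \<xi>)" for s t
      by (simp add: scaleR_add_left E.U_add)
    show "((\<lambda>t. (E.U (t *\<^sub>R \<xi>) v - v) /\<^sub>R t) \<longlongrightarrow> \<i> *\<^sub>C w) (at 0)"
      if "(v, w) \<in> affiliated_op E.A m \<Phi> (\<lambda>x. complex_of_real (T \<xi> x))" for v w
    proof -
      have "(v, w) \<in> S \<xi>" using that assms(17)[of \<xi>] by simp
      moreover have "S \<xi> = {(x, y). ((\<lambda>t. (E.U (t *\<^sub>R \<xi>) x - x) /\<^sub>R t) \<longlongrightarrow> \<i> *\<^sub>C y) (at 0)}"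
        using assms(10)[of \<xi>] unfolding is_exp_i_def E.U_def by blast
      ultimately show ?thesis by blast
    qed
  qed (rule T_meas)
  have T_add: "AE x in m. T (\<xi> + \<eta>) x = T \<xi> x + T \<eta> x" for \<xi> \<eta>
  proof (rule AE_eq_if_cis_eq)
    show "AE x in m. cis (t * T (\<xi> + \<eta>) x) = cis (t * (T \<xi> x + T \<eta> x))" for t
      using \<Phi>U[of t "\<xi> + \<eta>"] \<Phi>U[of t \<xi>] \<Phi>U[of t \<eta>] R.\<Phi>_comp[OF E.U_A E.U_A, of "t *\<^sub>R \<xi>" "t *\<^sub>R \<eta>"]
      unfolding scaleR_add_right E.U_add by eventually_elim (simp add: cis_mult distrib_left)
  qed
  have T_scale: "AE x in m. T (c *\<^sub>R \<xi>) x = c * T \<xi> x" for c \<xi>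
  proof (rule AE_eq_if_cis_eq)
    show "AE x in m. cis (t * T (c *\<^sub>R \<xi>) x) = cis (t * (c * T \<xi> x))" for t
      using \<Phi>U[of t "c *\<^sub>R \<xi>"] \<Phi>U[of "t * c" \<xi>]
      unfolding scaleR_scaleR by eventually_elim (simp add: mult.assoc)
  qed
  \<comment> \<open>With the inverse inside, translation by \<open>s\<close> is composition with
    \<open>\<theta> s\<close>.\<close>
  define \<theta> where "\<theta> s = act (inv\<^bsub>\<Gamma>\<^esub> s)" for s
  have \<theta>: "\<theta> s \<in> measurable m m \<and> distr m m (\<theta> s) = m" if "s \<in> carrier \<Gamma>" for s
    using assms(15) that by (simp add: measure_preserving_action_def \<theta>_def)
  have tr: "translate \<Gamma> act s h x = h (\<theta> s x)" for s x and h :: "'x \<Rightarrow> 'c"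
    by (simp add: translate_def \<theta>_def)
  have AE_\<theta>: "AE x in m. Q (\<theta> s x)" if s: "s \<in> carrier \<Gamma>" and "AE x in m. Q x" for s Q
  proof -
    have "distr m m (\<theta> s) = m" using \<theta>[OF s] ..
    then have "AE x in distr m m (\<theta> s). Q x" by (subst \<open>distr m m (\<theta> s) = m\<close>) (rule that(2))
    then show ?thesis using \<theta>[OF s] by (intro AE_distrD[where M = m and M' = m and f = "\<theta> s"]) auto
  qed
  have T_equi: "AE x in m. T \<xi> (\<theta> s x) = T (\<pi> s \<xi>) x" if s: "s \<in> carrier \<Gamma>" for s \<xi>
  proof (rule AE_eq_if_cis_eq)
    fix t
    have "\<pi> s (t *\<^sub>R \<xi>) = t *\<^sub>R \<pi> s \<xi>"
      by (rule linear_scale[OF bounded_linear.linear[OF E.\<pi>_linear[OF s]]])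
    then have "AE x in m. \<Phi> (E.U (t *\<^sub>R \<pi> s \<xi>)) x = \<Phi> (E.U (t *\<^sub>R \<xi>)) (\<theta> s x)"
      using assms(16)[OF s E.U_A, of "t *\<^sub>R \<xi>"] unfolding E.U_conj[OF s] tr by simp
    then show "AE x in m. cis (t * T \<xi> (\<theta> s x)) = cis (t * T (\<pi> s \<xi>) x)"
      using AE_\<theta>[OF s \<Phi>U[of t \<xi>]] \<Phi>U[of t "\<pi> s \<xi>"] by eventually_elim simp
  qed
  \<comment> \<open>Continuity of the embedding at 0, read at the trace vector: the squared norm of
    \<open>E.U \<xi> R.\<Omega> - R.\<Omega>\<close> is the integral of
    \<open>2 * (1 - cos (T \<xi> x))\<close>.\<close>
  have T_tight: "\<exists>\<delta>>0. \<forall>\<xi>. norm \<xi> \<le> \<delta> \<longrightarrow> prob {x\<in>space m. \<bar>T \<xi> x\<bar> > 2} \<le> e" if e: "e > 0" for e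
  proof -
    have U0: "E.U 0 = id" by (simp add: E.U_def E.\<alpha>_one)
    have "isCont (\<lambda>\<xi>. E.U \<xi> R.\<Omega>) 0"
      using E.continuous_U by (simp add: continuous_on_eq_continuous_at)
    then have "\<exists>d>0. \<forall>\<xi>. dist \<xi> 0 < d \<longrightarrow> dist (E.U \<xi> R.\<Omega>) (E.U 0 R.\<Omega>) < sqrt e"
      unfolding continuous_at_eps_delta using e by simp
    then obtain d where d: "d > 0" "\<And>\<xi>. norm \<xi> < d \<Longrightarrow> norm (E.U \<xi> R.\<Omega> - R.\<Omega>) < sqrt e"
      by (auto simp: dist_norm U0)
    \<comment> \<open>The radius \<open>d / 2\<close> keeps \<open>t *\<^sub>R \<xi>\<close>
      strictly inside the ball of radius \<open>d\<close>. The factor 2 before the cosine integral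
      offsets the doubling in \<open>prob_large_le\<close>.\<close>
    have "prob {x\<in>space m. \<bar>T \<xi> x\<bar> > 2} \<le> 2 * (e / 2)" if \<xi>: "norm \<xi> \<le> d / 2" for \<xi>
    proof (rule prob_large_le)
      fix t :: real assume t: "0 \<le> t" "t \<le> 1"
      define y where "y = (\<lambda>v. (-1) *\<^sub>C id v + E.U (t *\<^sub>R \<xi>) v)"
      have yA: "y \<in> E.A" unfolding y_def by (rule R.lincomb_A[OF R.id_A E.U_A])
      have "AE x in m. (cmod (\<Phi> y x))\<^sup>2 = 2 * (1 - cos (t * T \<xi> x))"
        using R.\<Phi>_lincomb[OF R.id_A E.U_A, of "-1" "t *\<^sub>R \<xi>"] R.\<Phi>_id \<Phi>U[of t \<xi>] unfolding y_def[symmetric]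
      proof eventually_elim
        case (elim x)
        have "(cmod (\<Phi> y x))\<^sup>2 = (cos (t * T \<xi> x) - 1)\<^sup>2 + (sin (t * T \<xi> x))\<^sup>2"
          by (simp add: elim cmod_power2)
        also have "\<dots> = 2 * (1 - cos (t * T \<xi> x))"
          using sin_cos_squared_add[of "t * T \<xi> x"] by (simp add: power2_diff)
        finally show ?case .
      qed
      then have "(norm (y R.\<Omega>))\<^sup>2 = (\<integral>x. 2 * (1 - cos (t * T \<xi> x)) \<partial>m)"
        unfolding R.norm_\<Omega>(2)[OF yA] by (intro integral_cong_AE) (use yA in measurable)
      also have "\<dots> = 2 * (\<integral>x. 1 - cos (t * T \<xi> x) \<partial>m)" by (rule integral_mult_right_zero)
      finally have "(\<integral>x. 1 - cos (t * T \<xi> x) \<partial>m) = (norm (y R.\<Omega>))\<^sup>2 / 2" by simp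
      moreover have "norm (t *\<^sub>R \<xi>) < d"
        using mult_left_le_one_le[of "norm \<xi>" t] t \<xi> d(1) by simp
      from d(2)[OF this] have "norm (y R.\<Omega>) < sqrt e"
        using scaleC_minus_left[of 1 R.\<Omega>] scaleC_of_real[of 1 R.\<Omega>] by (simp add: y_def)
      then have "(norm (y R.\<Omega>))\<^sup>2 \<le> (sqrt e)\<^sup>2" by (intro power_mono) auto
      ultimately show "(\<integral>x. 1 - cos (t * T \<xi> x) \<partial>m) \<le> e / 2" using e by simp
    qed (rule T_meas)
    then show ?thesis using d(1) by (intro exI[of _ "d / 2"]) auto
  qed

  \<comment> \<open>The invariant weight and its normalisation\<close>
  have "\<exists>g. g \<in> borel_measurable m \<and> (AE x in m. 0 < g x) \<and>
     (\<forall>s\<in>carrier \<Gamma>. AE x in m. g (\<theta> s x) = g x) \<and>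
     (\<forall>\<xi>. (E.orbit_norm \<xi>)\<^sup>2 \<le> 1 \<longrightarrow> integrable m (\<lambda>x. (g x)\<^sup>2 * (T \<xi> x)\<^sup>2) \<and> (\<integral>x. (g x)\<^sup>2 * (T \<xi> x)\<^sup>2 \<partial>m) \<le> 1)"
  \<comment> \<open>The gauge \<open>q\<close> is the square of the orbit norm, because the original
    norm need not be invariant under \<open>\<pi>\<close>.\<close>
  proof (rule equivariant_factorization[where p = \<pi>])
    have nn: "0 \<le> E.orbit_norm \<xi>" for \<xi> using E.norm_le_orbit_norm norm_ge_zero order_trans by blast
    show "(E.orbit_norm (c *\<^sub>R \<xi>))\<^sup>2 \<le> c\<^sup>2 * (E.orbit_norm \<xi>)\<^sup>2" for c \<xi>
      using power_mono[OF E.orbit_norm_scale nn, of c \<xi> 2] by (simp add: power_mult_distrib)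
    show "(norm \<xi>)\<^sup>2 \<le> (E.orbit_norm \<xi>)\<^sup>2" for \<xi>
      by (rule power_mono[OF E.norm_le_orbit_norm]) simp
    show "(E.orbit_norm (\<pi> s \<xi>))\<^sup>2 \<le> (E.orbit_norm \<xi>)\<^sup>2" if "s \<in> carrier \<Gamma>" for s \<xi>
      by (rule power_mono[OF E.orbit_norm_\<pi>[OF that] nn])
  qed (fact T_meas T_add T_scale T_tight \<theta> T_equi)+
  then obtain g where g [measurable]: "g \<in> borel_measurable m" and g_pos: "AE x in m. 0 < g x"
    and g_inv: "\<And>s. s \<in> carrier \<Gamma> \<Longrightarrow> AE x in m. g (\<theta> s x) = g x"
    and g_le: "\<And>\<xi>. (E.orbit_norm \<xi>)\<^sup>2 \<le> 1 \<Longrightarrow>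
      integrable m (\<lambda>x. (g x)\<^sup>2 * (T \<xi> x)\<^sup>2) \<and> (\<integral>x. (g x)\<^sup>2 * (T \<xi> x)\<^sup>2 \<partial>m) \<le> 1"
    by blast
  obtain C where C: "C > 0" "\<And>s \<xi>. s \<in> carrier \<Gamma> \<Longrightarrow> norm (\<pi> s \<xi>) \<le> C * norm \<xi>"
    using E.orbit_norm_bound by blast
  \<comment> \<open>The orbit norm is at most \<open>C * norm \<xi>\<close>, so passing from it to
    the original norm costs the factor \<open>C\<^sup>2\<close>.\<close>
  define \<phi> where "\<phi> x = (g x)\<^sup>2 / C\<^sup>2" for x
  have \<phi>_meas [measurable]: "\<phi> \<in> borel_measurable m" unfolding \<phi>_def by measurable
  have \<phi>_nonneg: "\<phi> x \<ge> 0" for x by (simp add: \<phi>_def)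
  have \<phi>_pos: "AE x in m. \<phi> x > 0"
    using g_pos by eventually_elim (use C(1) in \<open>simp add: \<phi>_def\<close>)
  have \<phi>_inv: "AE x in m. \<phi> (\<theta> s x) = \<phi> x" if "s \<in> carrier \<Gamma>" for s
    using g_inv[OF that] by eventually_elim (simp add: \<phi>_def)
  have bound: "integrable m (\<lambda>x. \<phi> x * (T \<xi> x)\<^sup>2) \<and> (\<integral>x. \<phi> x * (T \<xi> x)\<^sup>2 \<partial>m) \<le> (norm \<xi>)\<^sup>2" for \<xi>
  proof (cases "\<xi> = 0")
    case True
    have "AE x in m. \<phi> x * (T \<xi> x)\<^sup>2 = 0"
      using T_scale[of 0 \<xi>] by eventually_elim (simp add: True)
    then show ?thesis
      using integrable_cong_AE[of "\<lambda>x. \<phi> x * (T \<xi> x)\<^sup>2" m "\<lambda>_. 0"] True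
        integral_cong_AE[of "\<lambda>x. \<phi> x * (T \<xi> x)\<^sup>2" m "\<lambda>_. 0"] by simp
  next
    case False
    \<comment> \<open>The scaled vector has norm \<open>1 / C\<close>, hence orbit norm at most 1;
      the case \<open>\<xi> = 0\<close> had to be split off for this division.\<close>
    define c where "c = 1 / (C * norm \<xi>)"
    have c: "c > 0" using False C(1) by (simp add: c_def)
    have "E.orbit_norm (c *\<^sub>R \<xi>) \<le> 1"
    proof (rule E.orbit_norm_least)
      fix s assume s: "s \<in> carrier \<Gamma>"
      have "norm (\<pi> s (c *\<^sub>R \<xi>)) \<le> C * norm (c *\<^sub>R \<xi>)" by (rule C(2)[OF s])
      also have "\<dots> = 1" using False C(1) by (simp add: c_def)
      finally show "norm (\<pi> s (c *\<^sub>R \<xi>)) \<le> 1" .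
    qed
    moreover have "0 \<le> E.orbit_norm (c *\<^sub>R \<xi>)"
      using E.norm_le_orbit_norm norm_ge_zero order_trans by blast
    ultimately have "(E.orbit_norm (c *\<^sub>R \<xi>))\<^sup>2 \<le> 1" by (simp add: power_le_one)
    note le = g_le[OF this]
    have eq: "AE x in m. \<phi> x * (T \<xi> x)\<^sup>2 = (norm \<xi>)\<^sup>2 * ((g x)\<^sup>2 * (T (c *\<^sub>R \<xi>) x)\<^sup>2)"
      using T_scale[of c \<xi>]
    proof eventually_elim
      case (elim x)
      have "(norm \<xi>)\<^sup>2 * c\<^sup>2 = 1 / C\<^sup>2" using False by (simp add: c_def power_divide power_mult_distrib)
      then show ?case by (simp add: elim \<phi>_def power_mult_distrib ac_simps) (simp add: mult.assoc[symmetric])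
    qed
    have "integrable m (\<lambda>x. \<phi> x * (T \<xi> x)\<^sup>2)"
      using eq le by (subst integrable_cong_AE[OF _ _ eq]) auto
    moreover have "(\<integral>x. \<phi> x * (T \<xi> x)\<^sup>2 \<partial>m) = (norm \<xi>)\<^sup>2 * (\<integral>x. (g x)\<^sup>2 * (T (c *\<^sub>R \<xi>) x)\<^sup>2 \<partial>m)"
      by (subst integral_cong_AE[OF _ _ eq]) auto
    moreover have "\<dots> \<le> (norm \<xi>)\<^sup>2 * 1" using le by (intro mult_left_mono) auto
    ultimately show ?thesis by simp
  qed
  have sq: "(\<phi> x powr (1 / 2) * y)\<^sup>2 = \<phi> x * y\<^sup>2" for x y
    using \<phi>_nonneg[of x] by (simp add: powr_half_sqrt power_mult_distrib)
  show ?thesis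
    unfolding Let_def tr
  proof (intro exI[of _ \<phi>] conjI ballI allI)
    show "AE x in m. \<phi> (\<theta> s x) powr (- 1 / 2) = \<phi> x powr (- 1 / 2)" if "s \<in> carrier \<Gamma>" for s
      using \<phi>_inv[OF that] by eventually_elim simp
    show "(\<lambda>x. \<phi> x powr (1 / 2) * T \<xi> x) \<in> L2_real m" for \<xi>
      using bound[of \<xi>] by (simp add: L2_real_def sq)
    show "AE x in m. \<phi> x powr (1 / 2) * T (\<pi> s \<xi>) x = \<phi> (\<theta> s x) powr (1 / 2) * T \<xi> (\<theta> s x)"
      if "s \<in> carrier \<Gamma>" for s \<xi>
      using \<phi>_inv[OF that] T_equi[OF that, of \<xi>] by eventually_elim simp
    \<comment> \<open>At a zero of \<open>\<phi>\<close> both powers are 0 by convention, so the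
      cancellation relies on positivity almost everywhere.\<close>
    show "AE x in m. T \<xi> x = \<phi> x powr (- 1 / 2) * (\<phi> x powr (1 / 2) * T \<xi> x)" for \<xi>
      using \<phi>_pos by eventually_elim (simp add: powr_minus field_simps)
  qed (use \<phi>_pos \<phi>_inv bound in auto)
qed

end
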